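(* Let $\mathbb{D} \in \{\mathbb{R}, \mathbb{C}, \mathbb{H}\}$ and $n \geq 1$. Let $h : (0, \infty) \to (0, \infty)$ be a non-affine operator monotone function such that $h(1) = 1$, and let $f : (0,\infty) \to (0,\infty)$ be given by $f(x) = \sqrt{h(x)}$. Let $A, B \in \mathscr{P}_n(\mathbb{D})$. If the alternative mean $A \hat{\sigma}_f B$ is linearizable, i.e. there exist $a, b \in \mathbb{R}$ such that $A \hat{\sigma}_f B = aA + bB$, then $|\mathrm{Spec}(A^{-1} \sharp B)| \leq 2$ and $AB = BA$.
   Context: For $\mathbb{D} \in \{\mathbb{R}, \mathbb{C}, \mathbb{H}\}$ (reals, complexes, quaternions), $\mathrm{Mat}_n(\mathbb{D})$ is the set of $n \times n$ matrices over $\mathbb{D}$, $X^* = \overline{X}^{t}$ is the conjugate transpose, and $\mathscr{P}_n(\mathbb{D})$ is the set of $X \in \mathrm{Mat}_n(\mathbb{D})$ with $X = X^*$ and $X > 0$ (positive definite). Every $X \in \mathscr{P}_n(\mathbb{D})$ can be written $X = U \,\mathrm{diag}(d_1, \ldots, d_n)\, U^*$ with $U U^* = \mathrm{Id}_n$ and real $d_i > 0$; the $d_i$ are the eigenvalues of $X$ (right eigenvalues when $\mathbb{D} = \mathbb{H}$), and $\mathrm{Spec}(X)$ is the set of eigenvalues, so $|\mathrm{Spec}(X)|$ is the number of distinct eigenvalues. For a function $g : (0,\infty) \to (0,\infty)$, $g(X) = U\,\mathrm{diag}(g(d_1), \ldots, g(d_n))\,U^*$ (functional calculus); in particular real powers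 $X^t$ are so defined. A function $h : (0,\infty) \to (0,\infty)$ is operator monotone if $X \preceq Y$ implies $h(X) \preceq h(Y)$ for positive definite matrices $X, Y$ of any size, where $\preceq$ is the Loewner order. It is affine if it has the form $h(x) = \delta + \gamma x$ with constants $\delta, \gamma$. The geometric mean of $A, B \in \mathscr{P}_n(\mathbb{D})$ is $A \sharp B = A^{1/2}\left(A^{-1/2} B A^{-1/2}\right)^{1/2} A^{1/2}$; thus $A^{-1} \sharp B$ is the geometric mean of $A^{-1}$ and $B$. For a continuous function $f : (0,\infty) \to (0,\infty)$ with $f(1) = 1$, the alternative mean associated with $f$ is $$A \hat{\sigma}_f B = f\left(A^{-1} \sharp B\right) A\, f\left(A^{-1} \sharp B\right), \qquad A, B \in \mathscr{P}_n(\mathbb{D}).$$ *)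

theory Defs
  imports Complex_Main "Jordan_Normal_Form.Matrix"
begin

text \<open>
  Matrices are taken from \<open>Jordan_Normal_Form\<close>, over an entry type \<open>'a\<close> of sort
  \<open>{real_div_algebra, conjugate}\<close>. The intended entry types are \<open>real\<close>, \<open>complex\<close> and the
  type \<open>quat\<close> defined here. Multiplication of entries need not commute.
\<close>

subsection \<open>Quaternions\<close>

datatype quat = Quat (q_re: real) (q_i: real) (q_j: real) (q_k: real)

lemma quat_eq_iff:
  "x = y \<longleftrightarrow> q_re x = q_re y \<and> q_i x = q_i y \<and> q_j x = q_j y \<and> q_k x = q_k y"
  by (cases x; cases y) auto

instantiation quat :: real_div_algebra
begin

definition "0 = Quat 0 0 0 0"
definition "1 = Quat 1 0 0 0"
definition "x + y = Quat (q_re x + q_re y) (q_i x + q_i y) (q_j x + q_j y) (q_k x + q_k y)"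
definition "- x = Quat (- q_re x) (- q_i x) (- q_j x) (- q_k x)"
definition "x - y = Quat (q_re x - q_re y) (q_i x - q_i y) (q_j x - q_j y) (q_k x - q_k y)"
definition "r *\<^sub>R x = Quat (r * q_re x) (r * q_i x) (r * q_j x) (r * q_k x)"
definition "x * y = Quat
  (q_re x * q_re y - q_i x * q_i y - q_j x * q_j y - q_k x * q_k y)
  (q_re x * q_i y + q_i x * q_re y + q_j x * q_k y - q_k x * q_j y)
  (q_re x * q_j y - q_i x * q_k y + q_j x * q_re y + q_k x * q_i y)
  (q_re x * q_k y + q_i x * q_j y - q_j x * q_i y + q_k x * q_re y)"
definition "inverse x =
  inverse ((q_re x)\<^sup>2 + (q_i x)\<^sup>2 + (q_j x)\<^sup>2 + (q_k x)\<^sup>2) *\<^sub>R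
    Quat (q_re x) (- q_i x) (- q_j x) (- q_k x)"
definition "x div y = x * inverse y" for x y :: quat

lemmas quat_ops_def = zero_quat_def one_quat_def plus_quat_def uminus_quat_def
  minus_quat_def scaleR_quat_def times_quat_def

lemma quat_norm_sq_nonzero:
  "x \<noteq> 0 \<Longrightarrow> (q_re x)\<^sup>2 + (q_i x)\<^sup>2 + (q_j x)\<^sup>2 + (q_k x)\<^sup>2 \<noteq> 0"
  by (auto simp: quat_eq_iff zero_quat_def add_nonneg_eq_0_iff)

instance
proof
  fix x y z :: quat and r s :: real
  show "x * y * z = x * (y * z)" "(x + y) * z = x * z + y * z" "x * (y + z) = x * y + x * z"
    "x + y + z = x + (y + z)" "r *\<^sub>R (x + y) = r *\<^sub>R x + r *\<^sub>R y"
    "(r + s) *\<^sub>R x = r *\<^sub>R x + s *\<^sub>R x" "r *\<^sub>R x * y = r *\<^sub>R (x * y)"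
    "x * r *\<^sub>R y = r *\<^sub>R (x * y)"
    by (simp_all add: quat_eq_iff quat_ops_def algebra_simps)
  show "x + y = y + x" "0 + x = x" "- x + x = 0" "x - y = x + - y" "1 * x = x" "x * 1 = x"
    "(0::quat) \<noteq> 1" "r *\<^sub>R s *\<^sub>R x = (r * s) *\<^sub>R x" "1 *\<^sub>R x = x"
    by (simp_all add: quat_eq_iff quat_ops_def)
  show "x div y = x * inverse y"
    by (rule divide_quat_def)
  show "inverse (0::quat) = 0"
    by (simp add: inverse_quat_def quat_ops_def)
  assume "x \<noteq> 0"
  define N where "N = (q_re x)\<^sup>2 + (q_i x)\<^sup>2 + (q_j x)\<^sup>2 + (q_k x)\<^sup>2"
  have inv: "inverse x = inverse N *\<^sub>R Quat (q_re x) (- q_i x) (- q_j x) (- q_k x)"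
    by (simp add: inverse_quat_def N_def)
  have "inverse N * N = 1"
    using quat_norm_sq_nonzero[OF \<open>x \<noteq> 0\<close>] by (simp add: N_def)
  then have "inverse N * ((q_re x)\<^sup>2 + (q_i x)\<^sup>2 + (q_j x)\<^sup>2 + (q_k x)\<^sup>2) = 1"
    by (simp only: N_def)
  then show "inverse x * x = 1" "x * inverse x = 1"
    by (simp_all add: inv quat_eq_iff quat_ops_def algebra_simps power2_eq_square)
qed

end

instantiation quat :: conjugate
begin
definition "conjugate x = Quat (q_re x) (- q_i x) (- q_j x) (- q_k x)"
instance by standard (auto simp: conjugate_quat_def quat_eq_iff)
end


subsection \<open>Positive definite matrices and the Loewner order\<close>

definition conj_transpose :: "'a::conjugate mat \<Rightarrow> 'a mat"
  where "conj_transpose X = transpose_mat (map_mat conjugate X)"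

definition self_adjoint :: "'a::conjugate mat \<Rightarrow> bool"
  where "self_adjoint X \<longleftrightarrow> square_mat X \<and> conj_transpose X = X"

definition quad_form :: "'a::{real_div_algebra, conjugate} mat \<Rightarrow> 'a vec \<Rightarrow> 'a"
  where "quad_form X v = conjugate v \<bullet> (X *\<^sub>v v)"

text \<open>For self-adjoint \<open>X\<close> the value \<open>v\<^sup>* X v\<close> always lies in the copy of the reals inside \<open>'a\<close>,
  so positivity is expressed through \<open>of_real\<close>.\<close>

definition pos_def_mats :: "nat \<Rightarrow> 'a::{real_div_algebra, conjugate} mat set"
  where "pos_def_mats n = {X \<in> carrier_mat n n. self_adjoint X \<and>
    (\<forall>v \<in> carrier_vec n. v \<noteq> 0\<^sub>v n \<longrightarrow> (\<exists>r>0. quad_form X v = of_real r))}"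

definition pos_semidef_mats :: "nat \<Rightarrow> 'a::{real_div_algebra, conjugate} mat set"
  where "pos_semidef_mats n = {X \<in> carrier_mat n n. self_adjoint X \<and>
    (\<forall>v \<in> carrier_vec n. \<exists>r\<ge>0. quad_form X v = of_real r)}"

definition loewner_le :: "'a::{real_div_algebra, conjugate} mat \<Rightarrow> 'a mat \<Rightarrow> bool"
  where "loewner_le X Y \<longleftrightarrow> Y - X \<in> pos_semidef_mats (dim_row X)"


subsection \<open>Spectrum and functional calculus\<close>

text \<open>Right eigenvalues \<open>X v = v \<mu>\<close>; for \<open>real\<close> and \<open>complex\<close> these are the usual eigenvalues.
  The spectrum of a self-adjoint quaternionic matrix consists of real quaternions only, so there is
  no need to pass to similarity classes of eigenvalues.\<close>

definition spec :: "'a::{real_div_algebra, conjugate} mat \<Rightarrow> 'a set"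
  where "spec X = {\<mu>. \<exists>v \<in> carrier_vec (dim_row X). v \<noteq> 0\<^sub>v (dim_row X) \<and>
    X *\<^sub>v v = map_vec (\<lambda>x. x * \<mu>) v}"

definition diagonalizes ::
    "'a::{real_div_algebra, conjugate} mat \<Rightarrow> (nat \<Rightarrow> real) \<Rightarrow> 'a mat \<Rightarrow> bool"
  where "diagonalizes U d X \<longleftrightarrow>
    U \<in> carrier_mat (dim_row X) (dim_row X) \<and>
    U * conj_transpose U = 1\<^sub>m (dim_row X) \<and>
    (\<forall>i < dim_row X. d i > 0) \<and>
    X = U * mat_diag (dim_row X) (\<lambda>i. of_real (d i)) * conj_transpose U"

text \<open>Only meaningful for positive definite \<open>X\<close>, for which the result does not depend on the
  diagonalization. The values of \<open>g\<close> outside the positive reals are never used.\<close>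

definition fun_calc ::
    "(real \<Rightarrow> real) \<Rightarrow> 'a::{real_div_algebra, conjugate} mat \<Rightarrow> 'a mat"
  where "fun_calc g X = (THE Y. \<exists>U d. diagonalizes U d X \<and>
    Y = U * mat_diag (dim_row X) (\<lambda>i. of_real (g (d i))) * conj_transpose U)"

definition mat_powr :: "'a::{real_div_algebra, conjugate} mat \<Rightarrow> real \<Rightarrow> 'a mat"
  where "mat_powr X t = fun_calc (\<lambda>x. x powr t) X"


subsection \<open>Operator monotone functions and means\<close>

text \<open>As usual, operator monotonicity refers to complex matrices of all sizes.\<close>

definition operator_monotone :: "(real \<Rightarrow> real) \<Rightarrow> bool"
  where "operator_monotone h \<longleftrightarrow>
    (\<forall>n. \<forall>X \<in> pos_def_mats n. \<forall>Y \<in> pos_def_mats n.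
      loewner_le (X :: complex mat) Y \<longrightarrow> loewner_le (fun_calc h X) (fun_calc h Y))"

definition affine_on_pos :: "(real \<Rightarrow> real) \<Rightarrow> bool"
  where "affine_on_pos h \<longleftrightarrow> (\<exists>\<delta> \<gamma>. \<forall>x>0. h x = \<delta> + \<gamma> * x)"

definition geom_mean ::
    "'a::{real_div_algebra, conjugate} mat \<Rightarrow> 'a mat \<Rightarrow> 'a mat"
  where "geom_mean A B =
    mat_powr A (1/2) * mat_powr (mat_powr A (-1/2) * B * mat_powr A (-1/2)) (1/2)
      * mat_powr A (1/2)"

definition alt_mean ::
    "(real \<Rightarrow> real) \<Rightarrow> 'a::{real_div_algebra, conjugate} mat \<Rightarrow> 'a mat \<Rightarrow> 'a mat"
  where "alt_mean f A B =
    fun_calc f (geom_mean (mat_powr A (-1)) B) * A * fun_calc f (geom_mean (mat_powr A (-1)) B)"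

definition linearizable ::
    "(real \<Rightarrow> real) \<Rightarrow> 'a::{real_div_algebra, conjugate} mat \<Rightarrow> 'a mat \<Rightarrow> bool"
  where "linearizable f A B \<longleftrightarrow>
    (\<exists>a b :: real. alt_mean f A B = of_real a \<cdot>\<^sub>m A + of_real b \<cdot>\<^sub>m B)"

end

theory Submission
  imports Defs
begin

text \<open>
  Put \<open>C = A\<^sup>-\<^sup>1 \<sharp> B\<close>. This matrix is the positive definite solution of the Riccati equation
  \<open>C A C = B\<close> (\<open>geom_mean_inverse_pos_def\<close>), so linearizability reads
  \<open>f(C) A f(C) = a A + b C A C\<close>. In an orthonormal eigenbasis of \<open>C\<close>, with eigenvalues \<open>d\<^sub>i\<close>, and with
  \<open>M\<close> the matrix of \<open>A\<close> in that basis, the equation decouples into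
  \<open>(f(d\<^sub>i) f(d\<^sub>j) - a - b d\<^sub>i d\<^sub>j) M\<^sub>i\<^sub>j = 0\<close> (\<open>linearizable_eigenbasis\<close>).

  The diagonal entries of \<open>M\<close> are nonzero, hence \<open>h(d\<^sub>i) = a + b d\<^sub>i\<^sup>2\<close> for all \<open>i\<close>: the eigenvalues
  of \<open>C\<close> are points where \<open>h\<close> meets the parabola \<open>a + b x\<^sup>2\<close>. A strictly increasing
  function meets it twice only if \<open>b > 0\<close>, in which case it is strictly convex and the concave function \<open>h\<close>
  meets it at most twice. If there are two meeting points, then \<open>a \<noteq> 0\<close> as well, because \<open>h\<close> is concave
  and positive (\<open>two_parabola_points\<close>). Now if \<open>M\<^sub>i\<^sub>j \<noteq> 0\<close> with \<open>d\<^sub>i \<noteq> d\<^sub>j\<close>, squaring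
  \<open>f(d\<^sub>i) f(d\<^sub>j) = a + b d\<^sub>i d\<^sub>j\<close> gives \<open>a b (d\<^sub>i - d\<^sub>j)\<^sup>2 = 0\<close>, a contradiction. So \<open>A\<close> commutes with \<open>C\<close>,
  and therefore with \<open>B = C A C\<close> (\<open>linearizable_alt_mean\<close>).

  Two ingredients have to be supplied. The properties of \<open>h\<close> (it is increasing, concave, and strictly
  increasing unless constant) come from comparing real symmetric matrices of size two with diagonal
  ones. The spectral theorem and the functional calculus are needed over all three entry types at once.
  They are proved over any real division algebra whose involution has real fixed points and
  satisfies \<open>x\<^sup>* x \<ge> 0\<close>. Commutativity, determinants and characteristic polynomials are avoided:
  eigenvectors are found as maximizers of the Rayleigh quotient, whose existence follows
  from iterated Schur complements, and one-sided inverses of unitary matrices are shown to be two-sided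
  by computing a trace.
\<close>

section \<open>Division algebras with involution\<close>

text \<open>Conjugation reverses products, as it does for quaternions. The last two axioms stand in for
  commutativity: self-conjugate elements, and in particular \<open>x\<^sup>* x\<close>, are real multiples of \<open>1\<close>
  and so commute with everything.\<close>

class star_division = real_div_algebra + conjugate +
  assumes conjugate_add: "conjugate (x + y) = conjugate x + conjugate y"
    and conjugate_mult: "conjugate (x * y) = conjugate y * conjugate x"
    and conjugate_scaleR: "conjugate (scaleR r x) = scaleR r (conjugate x)"
    and self_conjugate_imp_real: "conjugate x = x \<Longrightarrow> \<exists>r. x = scaleR r 1"
    and conjugate_mult_self_nonneg: "\<exists>r\<ge>0. conjugate x * x = scaleR r 1"

instance real :: star_division
  by standard auto

instance complex :: star_division
proof
  fix x y :: complex and r :: real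
  show "conjugate x = x \<Longrightarrow> \<exists>r. x = r *\<^sub>R 1"
    by (intro exI[of _ "Re x"]) (auto simp: complex_eq_iff)
  show "\<exists>r\<ge>0. conjugate x * x = r *\<^sub>R 1"
    by (intro exI[of _ "(Re x)\<^sup>2 + (Im x)\<^sup>2"]) (auto simp: complex_eq_iff power2_eq_square)
qed auto

instance quat :: star_division
proof
  fix x y :: quat and r :: real
  show "conjugate (x + y) = conjugate x + conjugate y"
    "conjugate (x * y) = conjugate y * conjugate x"
    "conjugate (r *\<^sub>R x) = r *\<^sub>R conjugate x"
    by (simp_all add: quat_eq_iff quat_ops_def conjugate_quat_def algebra_simps)
  show "conjugate x = x \<Longrightarrow> \<exists>r. x = r *\<^sub>R 1"
    by (intro exI[of _ "q_re x"]) (auto simp: quat_eq_iff quat_ops_def conjugate_quat_def)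
  show "\<exists>r\<ge>0. conjugate x * x = r *\<^sub>R 1"
    by (intro exI[of _ "(q_re x)\<^sup>2 + (q_i x)\<^sup>2 + (q_j x)\<^sup>2 + (q_k x)\<^sup>2"])
      (auto simp: quat_eq_iff quat_ops_def conjugate_quat_def power2_eq_square algebra_simps)
qed

lemma star_conjugate_zero [simp]: "conjugate (0::'a::star_division) = 0"
  using conjugate_scaleR[of 0 "0::'a"] by simp

lemma star_conjugate_minus [simp]: "conjugate (- x) = - conjugate (x::'a::star_division)"
  using conjugate_scaleR[of "-1" x] by simp

lemma star_conjugate_diff [simp]: "conjugate (x - y) = conjugate x - conjugate (y::'a::star_division)"
  using conjugate_add[of x "- y"] by simp

lemma star_conjugate_one [simp]: "conjugate (1::'a::star_division) = 1"
  by (metis conjugate_id conjugate_mult mult_1 mult_1_right)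

lemma star_conjugate_of_real [simp]: "conjugate (of_real r :: 'a::star_division) = of_real r"
  by (simp add: of_real_def conjugate_scaleR)

lemma star_conjugate_sum: "conjugate (sum f I) = (\<Sum>i\<in>I. conjugate (f i :: 'a::star_division))"
  by (induction I rule: infinite_finite_induct) (simp_all add: conjugate_add)

lemma star_conjugate_eq_0_iff [simp]: "conjugate x = 0 \<longleftrightarrow> x = (0::'a::star_division)"
  by (metis conjugate_id star_conjugate_zero)

lemma real_scalar_commute: "x * of_real r = of_real r * (x :: 'a::star_division)"
  by (simp add: of_real_def)

definition real_part :: "'a::star_division \<Rightarrow> real"
  where "real_part x = (THE r. of_real r = (1/2) *\<^sub>R (x + conjugate x))"

lemma of_real_real_part: "of_real (real_part x) = (1/2) *\<^sub>R (x + conjugate (x::'a::star_division))"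
proof -
  have "conjugate ((1/2) *\<^sub>R (x + conjugate x)) = (1/2) *\<^sub>R (x + conjugate x)"
    by (simp add: conjugate_scaleR conjugate_add add.commute)
  then obtain r where r: "of_real r = (1/2) *\<^sub>R (x + conjugate x)"
    using self_conjugate_imp_real by (metis of_real_def)
  show ?thesis
    unfolding real_part_def by (rule theI[where a = r]) (metis r of_real_eq_iff)+
qed

lemma real_part_eqI: "(1/2) *\<^sub>R (x + conjugate (x::'a::star_division)) = of_real r \<Longrightarrow> real_part x = r"
  using of_real_real_part[of x] by simp

lemma real_part_of_real [simp]: "real_part (of_real r :: 'a::star_division) = r"
proof (rule real_part_eqI)
  have "(1/2) *\<^sub>R (of_real r + of_real r :: 'a) = of_real r"
    by (simp add: of_real_def flip: scaleR_add_left)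
  then show "(1/2) *\<^sub>R (of_real r + conjugate (of_real r :: 'a)) = of_real r" by simp
qed

lemma real_part_zero [simp]: "real_part (0::'a::star_division) = 0"
  using real_part_of_real[of 0, where 'a='a] by simp

lemma real_part_one [simp]: "real_part (1::'a::star_division) = 1"
  using real_part_of_real[of 1, where 'a='a] by simp

lemma real_part_add [simp]: "real_part (x + y) = real_part x + real_part (y::'a::star_division)"
  by (rule real_part_eqI) (simp add: of_real_real_part conjugate_add algebra_simps)

lemma real_part_scaleR [simp]: "real_part (r *\<^sub>R x) = r * real_part (x::'a::star_division)"
  by (rule real_part_eqI) (simp add: of_real_real_part conjugate_scaleR algebra_simps flip: scaleR_conv_of_real)

lemma real_part_minus [simp]: "real_part (- x) = - real_part (x::'a::star_division)"
  using real_part_scaleR[of "-1" x] by simp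

lemma real_part_diff [simp]: "real_part (x - y) = real_part x - real_part (y::'a::star_division)"
  using real_part_add[of x "- y"] by simp

lemma real_part_sum: "real_part (sum f I) = (\<Sum>i\<in>I. real_part (f i :: 'a::star_division))"
  by (induction I rule: infinite_finite_induct) simp_all

lemma real_part_conjugate [simp]: "real_part (conjugate x) = real_part (x::'a::star_division)"
  by (rule real_part_eqI) (simp add: of_real_real_part add.commute)

lemma of_real_real_part_self_conjugate: "conjugate x = x \<Longrightarrow> of_real (real_part x) = (x::'a::star_division)"
  by (simp add: of_real_real_part flip: scaleR_2)

definition normsq :: "'a::star_division \<Rightarrow> real"
  where "normsq x = real_part (conjugate x * x)"

lemma conjugate_mult_self: "conjugate x * x = of_real (normsq (x::'a::star_division))"
  by (simp add: normsq_def of_real_real_part_self_conjugate conjugate_mult)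

lemma normsq_nonneg [simp]: "normsq (x::'a::star_division) \<ge> 0"
proof -
  obtain r where "r \<ge> 0" "conjugate x * x = of_real r"
    using conjugate_mult_self_nonneg[of x] by (auto simp: of_real_def)
  then show ?thesis by (simp add: normsq_def)
qed

lemma normsq_eq_0_iff [simp]: "normsq x = 0 \<longleftrightarrow> x = (0::'a::star_division)"
proof
  assume "normsq x = 0"
  then have "conjugate x * x = 0" by (simp add: conjugate_mult_self)
  then show "x = 0" by simp
qed (simp add: normsq_def)

lemma normsq_zero [simp]: "normsq (0::'a::star_division) = 0"
  by simp

lemma normsq_minus [simp]: "normsq (- x) = normsq (x::'a::star_division)"
  by (simp add: normsq_def)

text \<open>Since \<open>x\<^sup>* x\<close> is real, \<open>x x\<^sup>* x\<close> equals both \<open>(x x\<^sup>*) x\<close> and \<open>(x\<^sup>* x) x\<close>; cancel \<open>x\<close> on the right.\<close>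

lemma mult_conjugate_self: "x * conjugate x = of_real (normsq (x::'a::star_division))"
proof (cases "x = 0")
  case False
  have "x * conjugate x * x = x * of_real (normsq x)"
    by (simp add: mult.assoc conjugate_mult_self)
  also have "\<dots> = of_real (normsq x) * x"
    by (rule real_scalar_commute)
  finally show ?thesis using False by simp
qed simp

lemma normsq_mult: "normsq (x * y) = normsq x * normsq (y::'a::star_division)"
proof -
  have "of_real (normsq (x * y)) = conjugate y * (conjugate x * x) * y"
    by (simp add: conjugate_mult mult.assoc flip: conjugate_mult_self)
  also have "\<dots> = of_real (normsq x) * conjugate y * y"
    by (simp only: conjugate_mult_self[of x] real_scalar_commute[of "conjugate y"])
  also have "\<dots> = of_real (normsq x * normsq y)"
    by (simp add: mult.assoc conjugate_mult_self)
  finally show ?thesis by (simp only: of_real_eq_iff)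
qed

lemma normsq_scaleR [simp]: "normsq (r *\<^sub>R x) = r\<^sup>2 * normsq (x::'a::star_division)"
  by (simp add: normsq_def conjugate_scaleR power2_eq_square)

lemma normsq_add:
  "normsq (x + y) = normsq x + 2 * real_part (conjugate x * y) + normsq (y::'a::star_division)"
proof -
  have "real_part (conjugate y * x) = real_part (conjugate x * y)"
    using real_part_conjugate[of "conjugate x * y"] by (simp add: conjugate_mult)
  then show ?thesis by (simp add: normsq_def conjugate_add algebra_simps)
qed

lemma normsq_add_le: "normsq (x + y) \<le> 2 * normsq x + 2 * normsq (y::'a::star_division)"
  using normsq_add[of x y] normsq_add[of x "- y"] normsq_nonneg[of "x - y"]
  by simp

lemma real_part_conjugate_mult_le: "2 * \<bar>real_part (conjugate x * y)\<bar> \<le> normsq x + normsq (y::'a::star_division)"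
  using normsq_add[of x y] normsq_add[of x "- y"] normsq_nonneg[of "x - y"] normsq_nonneg[of "x + y"]
  by simp

section \<open>Hermitian forms on column vectors\<close>

text \<open>Vectors are functions of which only the values below \<open>n\<close> count, so that an induction on \<open>n\<close>
  restricts a form to fewer coordinates without changing vectors or matrices. Scalars act on vectors from
  the right.\<close>

definition inner :: "nat \<Rightarrow> (nat \<Rightarrow> 'a::star_division) \<Rightarrow> (nat \<Rightarrow> 'a) \<Rightarrow> 'a"
  where "inner n v w = (\<Sum>i<n. conjugate (v i) * w i)"

definition mat_app :: "nat \<Rightarrow> (nat \<Rightarrow> nat \<Rightarrow> 'a::star_division) \<Rightarrow> (nat \<Rightarrow> 'a) \<Rightarrow> nat \<Rightarrow> 'a"
  where "mat_app n M v i = (\<Sum>j<n. M i j * v j)"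

definition herm_form :: "nat \<Rightarrow> (nat \<Rightarrow> nat \<Rightarrow> 'a::star_division) \<Rightarrow> (nat \<Rightarrow> 'a) \<Rightarrow> real"
  where "herm_form n M v = real_part (inner n v (mat_app n M v))"

definition vec_normsq :: "nat \<Rightarrow> (nat \<Rightarrow> 'a::star_division) \<Rightarrow> real"
  where "vec_normsq n v = (\<Sum>i<n. normsq (v i))"

definition hermitian :: "nat \<Rightarrow> (nat \<Rightarrow> nat \<Rightarrow> 'a::star_division) \<Rightarrow> bool"
  where "hermitian n M \<longleftrightarrow> (\<forall>i<n. \<forall>j<n. conjugate (M i j) = M j i)"

lemma hermitianD: "hermitian n M \<Longrightarrow> i < n \<Longrightarrow> j < n \<Longrightarrow> conjugate (M i j) = M j i"
  by (simp add: hermitian_def)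

lemma conjugate_inner: "conjugate (inner n v w) = inner n w v"
  by (simp add: inner_def star_conjugate_sum conjugate_mult)

lemma inner_add_right: "inner n v (\<lambda>i. w i + x i) = inner n v w + inner n v x"
  by (simp add: inner_def sum.distrib algebra_simps)

lemma inner_diff_right: "inner n v (\<lambda>i. w i - x i) = inner n v w - inner n v x"
  by (simp add: inner_def sum_subtractf algebra_simps)

lemma inner_scaleR_right: "inner n v (\<lambda>i. r *\<^sub>R w i) = r *\<^sub>R inner n v w"
  by (simp add: inner_def scaleR_sum_right)

lemma inner_mult_right: "inner n v (\<lambda>i. w i * a) = inner n v w * a"
  by (simp add: inner_def sum_distrib_right mult.assoc)

lemma inner_sum_right: "inner n v (\<lambda>i. \<Sum>a\<in>I. w a i) = (\<Sum>a\<in>I. inner n v (w a))"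
  unfolding inner_def by (simp add: sum_distrib_left) (rule sum.swap)

lemma inner_add_left: "inner n (\<lambda>i. w i + x i) v = inner n w v + inner n x v"
  by (simp add: inner_def sum.distrib algebra_simps conjugate_add)

lemma inner_scaleR_left: "inner n (\<lambda>i. r *\<^sub>R w i) v = r *\<^sub>R inner n w v"
  by (simp add: inner_def scaleR_sum_right conjugate_scaleR)

lemma inner_cong: "(\<And>i. i < n \<Longrightarrow> v i = v' i) \<Longrightarrow> (\<And>i. i < n \<Longrightarrow> w i = w' i) \<Longrightarrow> inner n v w = inner n v' w'"
  by (simp add: inner_def)

lemma inner_self: "inner n v v = of_real (vec_normsq n v)"
  by (simp add: inner_def vec_normsq_def conjugate_mult_self)

lemma vec_normsq_nonneg [simp]: "vec_normsq n v \<ge> 0"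
  by (simp add: vec_normsq_def sum_nonneg)

lemma vec_normsq_eq_0_iff: "vec_normsq n v = 0 \<longleftrightarrow> (\<forall>i<n. v i = 0)"
  by (simp add: vec_normsq_def sum_nonneg_eq_0_iff Ball_def)

lemma vec_normsq_pos: "i < n \<Longrightarrow> v i \<noteq> 0 \<Longrightarrow> vec_normsq n v > 0"
  using vec_normsq_eq_0_iff[of n v] vec_normsq_nonneg[of n v] by (metis less_eq_real_def)

lemma vec_normsq_scaleR: "vec_normsq n (\<lambda>i. r *\<^sub>R v i) = r\<^sup>2 * vec_normsq n v"
  by (simp add: vec_normsq_def sum_distrib_left)

lemma mat_app_add: "mat_app n M (\<lambda>i. v i + w i) = (\<lambda>i. mat_app n M v i + mat_app n M w i)"
  by (simp add: mat_app_def sum.distrib algebra_simps fun_eq_iff)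

lemma mat_app_scaleR: "mat_app n M (\<lambda>i. r *\<^sub>R v i) = (\<lambda>i. r *\<^sub>R mat_app n M v i)"
  by (simp add: mat_app_def scaleR_sum_right fun_eq_iff)

lemma inner_mat_app_hermitian:
  assumes "hermitian n M"
  shows "inner n (mat_app n M v) w = inner n v (mat_app n M w)"
proof -
  have "inner n (mat_app n M v) w = (\<Sum>i<n. \<Sum>j<n. conjugate (v j) * M j i * w i)"
    unfolding inner_def mat_app_def
    by (intro sum.cong refl)
      (simp add: star_conjugate_sum conjugate_mult sum_distrib_right hermitianD[OF assms])
  also have "\<dots> = (\<Sum>j<n. \<Sum>i<n. conjugate (v j) * M j i * w i)"
    by (rule sum.swap)
  also have "\<dots> = inner n v (mat_app n M w)"
    by (simp add: inner_def mat_app_def sum_distrib_left mult.assoc)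
  finally show ?thesis .
qed

text \<open>No good constant is needed here, so each summand is estimated separately by
  \<open>2 Re (x\<^sup>* y) \<le> |x|\<^sup>2 + |y|\<^sup>2\<close>.\<close>

lemma herm_form_bounded: "\<exists>c. \<forall>v. \<bar>herm_form n M v\<bar> \<le> c * vec_normsq n v"
proof (intro exI allI)
  fix v :: "nat \<Rightarrow> 'a"
  let ?S = "\<Sum>i<n. \<Sum>j<n. normsq (M i j)"
  have entry: "normsq (M i j) \<le> ?S" if "i < n" "j < n" for i j
  proof -
    have "normsq (M i j) \<le> (\<Sum>j<n. normsq (M i j))"
      using that by (intro member_le_sum) auto
    also have "\<dots> \<le> ?S"
      using that by (intro member_le_sum[of i _ "\<lambda>i. \<Sum>j<n. normsq (M i j)"]) (auto intro: sum_nonneg)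
    finally show ?thesis .
  qed
  have "\<bar>herm_form n M v\<bar> = \<bar>\<Sum>i<n. \<Sum>j<n. real_part (conjugate (v i) * (M i j * v j))\<bar>"
    by (simp add: herm_form_def inner_def mat_app_def real_part_sum sum_distrib_left)
  also have "\<dots> \<le> (\<Sum>i<n. \<bar>\<Sum>j<n. real_part (conjugate (v i) * (M i j * v j))\<bar>)"
    by (rule sum_abs)
  also have "\<dots> \<le> (\<Sum>i<n. \<Sum>j<n. \<bar>real_part (conjugate (v i) * (M i j * v j))\<bar>)"
    by (intro sum_mono sum_abs)
  also have "\<dots> \<le> (\<Sum>i<n. \<Sum>j<n. normsq (v i) + ?S * normsq (v j))"
  proof (intro sum_mono)
    fix i j assume "i \<in> {..<n}" "j \<in> {..<n}"
    then have "normsq (M i j) * normsq (v j) \<le> ?S * normsq (v j)"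
      by (intro mult_right_mono entry) auto
    then show "\<bar>real_part (conjugate (v i) * (M i j * v j))\<bar> \<le> normsq (v i) + ?S * normsq (v j)"
      using real_part_conjugate_mult_le[of "v i" "M i j * v j"] normsq_nonneg[of "v i"]
        normsq_nonneg[of "M i j * v j"]
      unfolding normsq_mult by linarith
  qed
  also have "\<dots> = (real n + real n * ?S) * vec_normsq n v"
    by (simp add: sum.distrib vec_normsq_def algebra_simps flip: sum_distrib_left sum_distrib_right)
  finally show "\<bar>herm_form n M v\<bar> \<le> (real n + real n * ?S) * vec_normsq n v" .
qed

lemma normsq_linear_bounded: "\<exists>c\<ge>0. \<forall>v. normsq (\<Sum>j<n. b j * v j) \<le> c * vec_normsq n (v :: nat \<Rightarrow> 'a::star_division)"
proof (induction n)
  case 0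
  then show ?case by (auto simp: vec_normsq_def)
next
  case (Suc n)
  then obtain c where c: "c \<ge> 0" "\<And>v. normsq (\<Sum>j<n. b j * v j) \<le> c * vec_normsq n v" by blast
  have "normsq (\<Sum>j<Suc n. b j * v j) \<le> (2 * c + 2 * normsq (b n)) * vec_normsq (Suc n) v" for v
  proof -
    have "normsq (\<Sum>j<Suc n. b j * v j) \<le> 2 * normsq (\<Sum>j<n. b j * v j) + 2 * (normsq (b n) * normsq (v n))"
      using normsq_add_le[of "\<Sum>j<n. b j * v j" "b n * v n"] by (simp add: normsq_mult)
    also have "\<dots> \<le> 2 * (c * vec_normsq n v) + 2 * (normsq (b n) * normsq (v n))"
      using c(2)[of v] by simp
    also have "\<dots> \<le> (2 * c + 2 * normsq (b n)) * (vec_normsq n v + normsq (v n))"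
      using c(1) by (simp add: algebra_simps mult_nonneg_nonneg)
    finally show ?thesis by (simp add: vec_normsq_def)
  qed
  with c(1) show ?case by (intro exI[of _ "2 * c + 2 * normsq (b n)"]) auto
qed

section \<open>Orthonormal eigenvectors\<close>

text \<open>Completing the square in the last coordinate; \<open>S\<close> is the Schur complement of the last diagonal entry.\<close>

lemma herm_form_Suc:
  fixes M :: "nat \<Rightarrow> nat \<Rightarrow> 'a::star_division"
  assumes herm: "hermitian (Suc n) M" and \<alpha>: "M n n = of_real \<alpha>" "\<alpha> \<noteq> 0"
  defines "S \<equiv> \<lambda>i j. M i j - (1/\<alpha>) *\<^sub>R (M i n * M n j)"
  shows "herm_form (Suc n) M v = \<alpha> * normsq (v n + (1/\<alpha>) *\<^sub>R mat_app n M v n) + herm_form n S v"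
proof -
  define \<beta> where "\<beta> = mat_app n M v n"
  have \<beta>': "inner n v (\<lambda>i. M i n) = conjugate \<beta>"
    unfolding inner_def \<beta>_def mat_app_def star_conjugate_sum
    by (intro sum.cong refl) (simp add: conjugate_mult hermitianD[OF herm])
  have appS: "mat_app n S v = (\<lambda>i. mat_app n M v i - (1/\<alpha>) *\<^sub>R (M i n * \<beta>))"
    by (simp add: fun_eq_iff mat_app_def S_def \<beta>_def sum_subtractf algebra_simps sum_distrib_left
        flip: scaleR_sum_right)
  have "inner n v (mat_app n S v) = inner n v (mat_app n M v) - (1/\<alpha>) *\<^sub>R (conjugate \<beta> * \<beta>)"
    unfolding appS inner_diff_right inner_scaleR_right inner_mult_right \<beta>' ..
  then have fS: "herm_form n S v = herm_form n M v - (1/\<alpha>) * normsq \<beta>"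
    by (simp add: herm_form_def normsq_def)
  have "inner (Suc n) v (mat_app (Suc n) M v) = inner n v (\<lambda>i. mat_app n M v i + M i n * v n)
      + conjugate (v n) * (\<beta> + M n n * v n)"
    by (simp add: inner_def mat_app_def \<beta>_def)
  also have "\<dots> = inner n v (mat_app n M v) + conjugate \<beta> * v n + conjugate (v n) * \<beta>
      + \<alpha> *\<^sub>R (conjugate (v n) * v n)"
    unfolding inner_add_right inner_mult_right \<beta>' \<alpha>(1)
    by (simp add: algebra_simps of_real_def)
  finally have "herm_form (Suc n) M v = herm_form n M v + real_part (conjugate \<beta> * v n) + real_part (conjugate (v n) * \<beta>)
      + \<alpha> * normsq (v n)"
    by (simp add: herm_form_def normsq_def)
  moreover have "real_part (conjugate \<beta> * v n) = real_part (conjugate (v n) * \<beta>)"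
    using real_part_conjugate[of "conjugate \<beta> * v n"] by (simp add: conjugate_mult)
  moreover have "\<alpha> * normsq (v n + (1/\<alpha>) *\<^sub>R \<beta>)
      = \<alpha> * normsq (v n) + 2 * real_part (conjugate (v n) * \<beta>) + (1/\<alpha>) * normsq \<beta>"
    using \<alpha>(2) by (simp add: normsq_add field_simps power2_eq_square)
  ultimately show ?thesis
    unfolding fS \<beta>_def[symmetric] by simp
qed

lemma inner_Suc: "inner (Suc n) v w = inner n v w + conjugate (v n) * w n"
  by (simp add: inner_def)

text \<open>This is the form in which compactness of the unit sphere is used: a form that is positive away from
  \<open>0\<close> is bounded below by a multiple of the squared norm. Induction on the size reduces the claim to the
  Schur complement, and both alternatives for the complement lift through \<open>herm_form_Suc\<close>.\<close>

lemma hermitian_positive_or_nonpositive_vector: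
  fixes M :: "nat \<Rightarrow> nat \<Rightarrow> 'a::star_division"
  assumes "hermitian n M"
  shows "(\<exists>\<epsilon>>0. \<forall>v. \<epsilon> * vec_normsq n v \<le> herm_form n M v) \<or> (\<exists>v. vec_normsq n v > 0 \<and> herm_form n M v \<le> 0)"
  using assms
proof (induction n arbitrary: M)
  case 0
  then show ?case by (auto simp: vec_normsq_def herm_form_def inner_def intro: exI[of _ 1])
next
  case (Suc n)
  define \<alpha> where "\<alpha> = real_part (M n n)"
  have \<alpha>: "M n n = of_real \<alpha>"
    unfolding \<alpha>_def by (rule of_real_real_part_self_conjugate[symmetric]) (simp add: hermitianD[OF Suc.prems])
  show ?case
  proof (cases "\<alpha> \<le> 0")
    case True
    define v :: "nat \<Rightarrow> 'a" where "v = (\<lambda>i. if i = n then 1 else 0)"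
    have "herm_form (Suc n) M v = \<alpha>"
      by (simp add: herm_form_def inner_Suc mat_app_def v_def \<alpha> inner_def if_distrib sum.If_cases cong: if_cong)
    moreover have "vec_normsq (Suc n) v > 0"
      by (rule vec_normsq_pos[of n]) (auto simp: v_def)
    ultimately show ?thesis using True by auto
  next
    case False
    then have "\<alpha> > 0" by simp
    define S where "S = (\<lambda>i j. M i j - (1/\<alpha>) *\<^sub>R (M i n * M n j))"
    have split: "herm_form (Suc n) M v = \<alpha> * normsq (v n + (1/\<alpha>) *\<^sub>R mat_app n M v n) + herm_form n S v" for v
      unfolding S_def using Suc.prems \<alpha> \<open>\<alpha> > 0\<close> by (intro herm_form_Suc) auto
    have "hermitian n S"
      using Suc.prems by (simp add: hermitian_def S_def conjugate_scaleR conjugate_mult)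
    from Suc.IH[OF this] show ?thesis
    proof (elim disjE exE conjE)
      fix v assume v: "vec_normsq n v > 0" "herm_form n S v \<le> 0"
      \<comment> \<open>The last coordinate is chosen to make the square in the decomposition vanish.\<close>
      define w where "w = (\<lambda>i. if i = n then - ((1/\<alpha>) *\<^sub>R mat_app n M v n) else v i)"
      have "mat_app n M w n = mat_app n M v n" "herm_form n S w = herm_form n S v" "vec_normsq n w = vec_normsq n v"
        by (simp_all add: w_def mat_app_def herm_form_def inner_def vec_normsq_def)
      moreover have "w n = - ((1/\<alpha>) *\<^sub>R mat_app n M v n)"
        by (simp add: w_def)
      ultimately have "herm_form (Suc n) M w \<le> 0" "vec_normsq n w > 0"
        using v by (simp_all add: split)
      moreover have "vec_normsq (Suc n) w \<ge> vec_normsq n w"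
        by (simp add: vec_normsq_def)
      ultimately show ?thesis by (intro disjI2 exI[of _ w]) auto
    next
      fix \<epsilon> :: real assume \<epsilon>: "\<epsilon> > 0" "\<forall>v. \<epsilon> * vec_normsq n v \<le> herm_form n S v"
      obtain K where K: "K \<ge> 0" "\<And>v. normsq (mat_app n M v n) \<le> K * vec_normsq n v"
        using normsq_linear_bounded[of "M n" n] unfolding mat_app_def by blast
      \<comment> \<open>The squared norm of the full vector is at most \<open>2 s + L |v|\<^sup>2\<close>, where \<open>s\<close> is the completed square;
        \<open>\<delta>\<close> is chosen so that \<open>\<delta>\<close> times this bound stays below the form.\<close>
      define L where "L = 1 + 2 * K / \<alpha>\<^sup>2"
      have L: "L > 0" using K by (simp add: L_def add_pos_nonneg)
      define \<delta> where "\<delta> = min (\<alpha> / 2) (\<epsilon> / L)"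
      have \<delta>: "\<delta> > 0" "2 * \<delta> \<le> \<alpha>" "\<delta> * L \<le> \<epsilon>"
        using \<open>\<alpha> > 0\<close> \<epsilon>(1) L by (auto simp: \<delta>_def min_def field_simps)
      have "\<delta> * vec_normsq (Suc n) v \<le> herm_form (Suc n) M v" for v
      proof -
        let ?s = "normsq (v n + (1/\<alpha>) *\<^sub>R mat_app n M v n)"
        have "normsq (v n) = normsq ((v n + (1/\<alpha>) *\<^sub>R mat_app n M v n) + (- 1/\<alpha>) *\<^sub>R mat_app n M v n)"
          by simp
        also have "\<dots> \<le> 2 * ?s + 2 * ((1/\<alpha>)\<^sup>2 * normsq (mat_app n M v n))"
          using normsq_add_le[of "v n + (1/\<alpha>) *\<^sub>R mat_app n M v n" "(- 1/\<alpha>) *\<^sub>R mat_app n M v n"]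
          by (simp add: power_divide)
        also have "\<dots> \<le> 2 * ?s + 2 * ((1/\<alpha>)\<^sup>2 * (K * vec_normsq n v))"
          using K(2)[of v] by (intro add_left_mono mult_left_mono) auto
        finally have "vec_normsq (Suc n) v \<le> 2 * ?s + L * vec_normsq n v"
          by (simp add: vec_normsq_def L_def algebra_simps power_divide)
        then have "\<delta> * vec_normsq (Suc n) v \<le> \<delta> * (2 * ?s + L * vec_normsq n v)"
          using \<delta>(1) by simp
        also have "\<dots> = (2 * \<delta>) * ?s + (\<delta> * L) * vec_normsq n v"
          by (simp add: algebra_simps)
        also have "\<dots> \<le> \<alpha> * ?s + \<epsilon> * vec_normsq n v"
          using \<delta> by (intro add_mono mult_right_mono) auto
        also have "\<dots> \<le> herm_form (Suc n) M v"
          using \<epsilon>(2) by (simp add: split)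
        finally show ?thesis .
      qed
      then show ?thesis using \<delta>(1) by blast
    qed
  qed
qed

lemma herm_form_add_scaled:
  fixes M :: "nat \<Rightarrow> nat \<Rightarrow> 'a::star_division"
  assumes "hermitian n M"
  shows "herm_form n M (\<lambda>i. v i + s *\<^sub>R w i)
    = herm_form n M v + 2 * s * real_part (inner n w (mat_app n M v)) + s\<^sup>2 * herm_form n M w"
proof -
  have "real_part (inner n v (mat_app n M w)) = real_part (inner n w (mat_app n M v))"
    using real_part_conjugate[of "inner n v (mat_app n M w)"]
    by (simp add: conjugate_inner inner_mat_app_hermitian[OF assms])
  then show ?thesis
    by (simp add: herm_form_def mat_app_add mat_app_scaleR inner_add_left inner_add_right inner_scaleR_left
        inner_scaleR_right power2_eq_square algebra_simps)
qed

lemma linear_term_zero: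
  fixes a b :: real
  assumes "\<And>s. 0 \<le> 2 * s * a + s\<^sup>2 * b"
  shows "a = 0"
proof (rule ccontr)
  assume "a \<noteq> 0"
  define s where "s = - a / (\<bar>b\<bar> + 1)"
  have "s * (2 * a + s * b) = 2 * s * a + s\<^sup>2 * b"
    by (simp add: algebra_simps power2_eq_square)
  then have "0 \<le> s * (2 * a + s * b)" using assms[of s] by simp
  moreover have "s * (\<bar>b\<bar> + 1) = - a" by (simp add: s_def)
  ultimately have "0 \<le> s * (- 2 * s * (\<bar>b\<bar> + 1) + s * b)"
    by (metis (no_types, opaque_lifting) minus_mult_minus mult.assoc)
  then have "0 \<le> s\<^sup>2 * (b - 2 * \<bar>b\<bar> - 2)" by (simp add: algebra_simps power2_eq_square)
  moreover have "s\<^sup>2 > 0" using \<open>a \<noteq> 0\<close> by (simp add: s_def)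
  ultimately have "b - 2 * \<bar>b\<bar> - 2 \<ge> 0" by (simp add: zero_le_mult_iff)
  then show False by linarith
qed

text \<open>The vector \<open>v\<close> minimizes the form, so the first variation vanishes in every direction,
  in particular in the direction \<open>M v\<close>, where it is \<open>2 |M v|\<^sup>2\<close>.\<close>

lemma nonneg_herm_form_isotropic_imp_kernel:
  fixes M :: "nat \<Rightarrow> nat \<Rightarrow> 'a::star_division"
  assumes herm: "hermitian n M" and nonneg: "\<And>v. herm_form n M v \<ge> 0" and v: "herm_form n M v \<le> 0"
    and i: "i < n"
  shows "mat_app n M v i = 0"
proof -
  define w where "w = mat_app n M v"
  have "0 \<le> 2 * s * real_part (inner n w w) + s\<^sup>2 * herm_form n M w" for s
    using nonneg[of "\<lambda>i. v i + s *\<^sub>R w i"] v unfolding herm_form_add_scaled[OF herm] w_def by linarith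
  then have "real_part (inner n w w) = 0" by (rule linear_term_zero)
  then have "vec_normsq n w = 0" by (simp add: inner_self)
  then show ?thesis using i by (simp add: vec_normsq_eq_0_iff w_def)
qed

text \<open>Let \<open>t\<close> be the supremum of the Rayleigh quotient. The form of \<open>t - M\<close> is nonnegative but not bounded
  below by a positive multiple of the squared norm, for otherwise \<open>t\<close> could be lowered. So it vanishes at
  some nonzero vector, which lies in the kernel.\<close>

lemma hermitian_top_eigenvector:
  fixes M :: "nat \<Rightarrow> nat \<Rightarrow> 'a::star_division"
  assumes herm: "hermitian n M" and n: "n > 0"
  shows "\<exists>t v. vec_normsq n v > 0 \<and> (\<forall>i<n. mat_app n M v i = t *\<^sub>R v i) \<and> (\<forall>w. herm_form n M w \<le> t * vec_normsq n w)"
proof -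
  define S where "S = {herm_form n M w / vec_normsq n w | w. vec_normsq n w > 0}"
  define t where "t = Sup S"
  obtain c where c: "\<And>w. \<bar>herm_form n M w\<bar> \<le> c * vec_normsq n w"
    using herm_form_bounded[of n M] by blast
  have "bdd_above S"
    unfolding S_def bdd_above_def
    by (intro exI[of _ c]) (use c in \<open>auto simp: pos_divide_le_eq intro: order_trans[OF abs_ge_self]\<close>)
  have ne: "S \<noteq> {}"
    using vec_normsq_pos[of 0 n "\<lambda>_. 1 :: 'a"] n unfolding S_def by auto
  have le: "herm_form n M w \<le> t * vec_normsq n w" for w
  proof (cases "vec_normsq n w > 0")
    case True
    then have "herm_form n M w / vec_normsq n w \<le> t"
      unfolding t_def by (intro cSup_upper \<open>bdd_above S\<close>) (auto simp: S_def)
    then show ?thesis using True by (simp add: pos_divide_le_eq)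
  next
    case False
    then have "vec_normsq n w = 0" using vec_normsq_nonneg[of n w] by simp
    then show ?thesis using c[of w] by simp
  qed
  define N where "N = (\<lambda>i j. (if i = j then of_real t else 0) - M i j)"
  have appN: "mat_app n N w i = t *\<^sub>R w i - mat_app n M w i" if "i < n" for w i
  proof -
    have "mat_app n N w i = (\<Sum>j<n. (if j = i then t *\<^sub>R w j else 0) - M i j * w j)"
      unfolding mat_app_def N_def by (intro sum.cong refl) (auto simp: algebra_simps of_real_def)
    then show ?thesis using that by (simp add: sum_subtractf mat_app_def)
  qed
  have formN: "herm_form n N w = t * vec_normsq n w - herm_form n M w" for w
  proof -
    have "inner n w (mat_app n N w) = inner n w (\<lambda>i. t *\<^sub>R w i - mat_app n M w i)"
      by (rule inner_cong) (simp_all add: appN)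
    then show ?thesis
      by (simp add: herm_form_def inner_diff_right inner_scaleR_right inner_self)
  qed
  have hermN: "hermitian n N"
    using herm by (auto simp: hermitian_def N_def)
  have "\<not> (\<exists>\<epsilon>>0. \<forall>v. \<epsilon> * vec_normsq n v \<le> herm_form n N v)"
  proof
    assume "\<exists>\<epsilon>>0. \<forall>v. \<epsilon> * vec_normsq n v \<le> herm_form n N v"
    then obtain \<epsilon> where \<epsilon>: "\<epsilon> > 0" "\<And>v. herm_form n M v \<le> (t - \<epsilon>) * vec_normsq n v"
      by (auto simp: formN algebra_simps)
    have "t \<le> t - \<epsilon>"
      unfolding t_def[of] by (rule cSup_least[OF ne]) (use \<epsilon>(2) in \<open>auto simp: S_def pos_divide_le_eq t_def\<close>)
    then show False using \<epsilon>(1) by simp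
  qed
  then obtain v where v: "vec_normsq n v > 0" "herm_form n N v \<le> 0"
    using hermitian_positive_or_nonpositive_vector[OF hermN] by blast
  have "mat_app n M v i = t *\<^sub>R v i" if "i < n" for i
    using nonneg_herm_form_isotropic_imp_kernel[OF hermN _ v(2) that] le appN[OF that, of v]
    by (simp add: formN)
  with v(1) le show ?thesis by blast
qed

text \<open>The projection \<open>P\<close> onto the orthogonal complement has trace \<open>n - k > 0\<close>, hence a nonzero column.\<close>

lemma orthonormal_extend:
  fixes u :: "nat \<Rightarrow> nat \<Rightarrow> 'a::star_division"
  assumes ortho: "\<And>a b. a < k \<Longrightarrow> b < k \<Longrightarrow> inner n (u a) (u b) = (if a = b then 1 else 0)"
    and "k < n"
  shows "\<exists>w. vec_normsq n w > 0 \<and> (\<forall>a<k. inner n (u a) w = 0)"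
proof -
  define P where "P = (\<lambda>j i. (if i = j then 1 else 0) - (\<Sum>a<k. u a i * conjugate (u a j)))"
  have P: "inner n (u b) (P j) = 0" if "b < k" "j < n" for b j
  proof -
    have "inner n (u b) (P j) = inner n (u b) (\<lambda>i. if i = j then 1 else 0)
        - (\<Sum>a<k. inner n (u b) (u a) * conjugate (u a j))"
      by (simp add: P_def inner_diff_right inner_sum_right inner_mult_right)
    also have "(\<Sum>a<k. inner n (u b) (u a) * conjugate (u a j))
        = (\<Sum>a<k. if a = b then conjugate (u a j) else 0)"
      using that by (intro sum.cong) (auto simp: ortho)
    finally show ?thesis using that by (simp add: inner_def if_distrib cong: if_cong)
  qed
  have "(\<Sum>j<n. real_part (P j j)) = real n - (\<Sum>j<n. \<Sum>a<k. normsq (u a j))"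
    by (simp add: P_def sum_subtractf real_part_sum mult_conjugate_self)
  also have "(\<Sum>j<n. \<Sum>a<k. normsq (u a j)) = (\<Sum>a<k. \<Sum>j<n. normsq (u a j))"
    by (rule sum.swap)
  also have "\<dots> = (\<Sum>a<k. 1)"
  proof (rule sum.cong)
    fix a assume "a \<in> {..<k}"
    then have "of_real (vec_normsq n (u a)) = (of_real 1::'a)" using ortho[of a a] by (simp add: inner_self)
    then show "(\<Sum>j<n. normsq (u a j)) = 1" by (simp only: of_real_eq_iff vec_normsq_def)
  qed simp
  finally have "(\<Sum>j<n. real_part (P j j)) > 0" using \<open>k < n\<close> by simp
  then have "(\<Sum>j<n. real_part (P j j)) \<noteq> 0" by simp
  then obtain j where "j \<in> {..<n}" "real_part (P j j) \<noteq> 0"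
    by (rule sum.not_neutral_contains_not_neutral)
  then have j: "j < n" "P j j \<noteq> 0" by auto
  show ?thesis
    by (rule exI[of _ "P j"]) (use j P vec_normsq_pos[of j n "P j"] in auto)
qed

text \<open>Deflation: subtracting \<open>K\<close> times the projection onto the eigenvectors found so far lowers their
  eigenvalues by \<open>K\<close> and leaves the form unchanged on their orthogonal complement. For large \<open>K\<close> the top eigenvalue of
  the deflated matrix differs from all lowered ones, so its eigenvector is orthogonal to the earlier ones.\<close>

lemma hermitian_orthonormal_eigenvectors:
  fixes M :: "nat \<Rightarrow> nat \<Rightarrow> 'a::star_division"
  assumes herm: "hermitian n M" and "k \<le> n"
  shows "\<exists>u d. (\<forall>a<k. \<forall>b<k. inner n (u a) (u b) = (if a = b then 1 else 0)) \<and>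
    (\<forall>a<k. \<forall>i<n. mat_app n M (u a) i = d a *\<^sub>R u a i)"
  using \<open>k \<le> n\<close>
proof (induction k)
  case 0
  then show ?case by auto
next
  case (Suc k)
  then have "k \<le> n" by simp
  with Suc.IH obtain u d where ortho: "\<And>a b. a < k \<Longrightarrow> b < k \<Longrightarrow> inner n (u a) (u b) = (if a = b then 1 else 0)"
    and eig: "\<And>a i. a < k \<Longrightarrow> i < n \<Longrightarrow> mat_app n M (u a) i = d a *\<^sub>R u a i"
    by blast
  obtain c where c: "\<And>w. \<bar>herm_form n M w\<bar> \<le> c * vec_normsq n w"
    using herm_form_bounded[of n M] by blast
  \<comment> \<open>All values of the form on unit vectors lie in \<open>[-|c|, |c|]\<close>, so this \<open>K\<close> moves the old eigenvalues
    below that interval.\<close>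
  define K where "K = 2 * \<bar>c\<bar> + 1"
  define M' where "M' = (\<lambda>i j. M i j - K *\<^sub>R (\<Sum>a<k. u a i * conjugate (u a j)))"
  have appM': "mat_app n M' v = (\<lambda>i. mat_app n M v i - K *\<^sub>R (\<Sum>a<k. u a i * inner n (u a) v))" for v
  proof
    fix i
    have "mat_app n M' v i = mat_app n M v i - K *\<^sub>R (\<Sum>j<n. \<Sum>a<k. u a i * (conjugate (u a j) * v j))"
      by (simp add: mat_app_def M'_def left_diff_distrib sum_subtractf sum_distrib_right mult.assoc
          flip: scaleR_sum_right)
    also have "(\<Sum>j<n. \<Sum>a<k. u a i * (conjugate (u a j) * v j)) = (\<Sum>a<k. u a i * inner n (u a) v)"
      unfolding inner_def sum_distrib_left by (rule sum.swap)
    finally show "mat_app n M' v i = mat_app n M v i - K *\<^sub>R (\<Sum>a<k. u a i * inner n (u a) v)" .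
  qed
  have "hermitian n M'"
    using herm by (simp add: hermitian_def M'_def conjugate_scaleR star_conjugate_sum conjugate_mult)
  moreover have "n > 0" using Suc.prems by simp
  ultimately obtain t v where v: "vec_normsq n v > 0" "\<And>i. i < n \<Longrightarrow> mat_app n M' v i = t *\<^sub>R v i"
    and t: "\<And>w. herm_form n M' w \<le> t * vec_normsq n w"
    using hermitian_top_eigenvector[of n M'] by blast
  have "k < n" using Suc.prems by simp
  with ortho obtain w where w: "vec_normsq n w > 0" "\<And>a. a < k \<Longrightarrow> inner n (u a) w = 0"
    using orthonormal_extend[of k n u] by blast
  have "herm_form n M' w = herm_form n M w"
    by (simp add: herm_form_def appM' w(2))
  then have "(t + \<bar>c\<bar>) * vec_normsq n w \<ge> 0"
    using t[of w] c[of w] mult_right_mono[OF abs_ge_self[of c] vec_normsq_nonneg[of n w]]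
    by (simp add: algebra_simps)
  then have t_ge: "t \<ge> - \<bar>c\<bar>" using w(1) by (simp add: zero_le_mult_iff)
  have orth: "inner n (u b) v = 0" if "b < k" for b
  proof -
    have nsq1: "vec_normsq n (u b) = 1"
      using ortho[OF that that] by (simp add: inner_self)
    have "inner n (u b) (mat_app n M (u b)) = inner n (u b) (\<lambda>i. d b *\<^sub>R u b i)"
      by (rule inner_cong) (simp_all add: eig that)
    then have "herm_form n M (u b) = d b"
      by (simp add: herm_form_def inner_scaleR_right inner_self nsq1)
    then have "d b \<le> \<bar>c\<bar>" using c[of "u b"] nsq1 by simp
    have "t *\<^sub>R inner n (u b) v = inner n (u b) (mat_app n M' v)"
      unfolding inner_scaleR_right[symmetric] by (rule inner_cong) (simp_all add: v(2))
    also have "\<dots> = inner n (mat_app n M (u b)) v - K *\<^sub>R (\<Sum>a<k. inner n (u b) (u a) * inner n (u a) v)"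
      by (simp add: appM' inner_diff_right inner_scaleR_right inner_sum_right inner_mult_right
          inner_mat_app_hermitian[OF herm])
    also have "inner n (mat_app n M (u b)) v = d b *\<^sub>R inner n (u b) v"
      unfolding inner_scaleR_left[symmetric] by (rule inner_cong) (simp_all add: eig that)
    also have "(\<Sum>a<k. inner n (u b) (u a) * inner n (u a) v)
        = (\<Sum>a<k. if a = b then inner n (u a) v else 0)"
      using that by (intro sum.cong) (auto simp: ortho)
    also have "\<dots> = inner n (u b) v" using that by simp
    finally have "(t - d b + K) *\<^sub>R inner n (u b) v = 0"
      by (simp add: algebra_simps)
    moreover have "t - d b + K > 0"
      using t_ge \<open>d b \<le> \<bar>c\<bar>\<close> by (simp add: K_def)
    ultimately show ?thesis by simp
  qed
  define x where "x = (\<lambda>i. (1 / sqrt (vec_normsq n v)) *\<^sub>R v i)"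
  have x_eig: "mat_app n M x i = t *\<^sub>R x i" if "i < n" for i
    using v(2)[OF that] by (simp add: x_def mat_app_scaleR appM' orth)
  have "inner n x x = 1"
    using v(1) unfolding inner_self by (simp add: x_def vec_normsq_scaleR power_divide)
  moreover have "inner n (u b) x = 0" "inner n x (u b) = 0" if "b < k" for b
    using orth[OF that] conjugate_inner[of n "u b" v]
    by (simp_all add: x_def inner_scaleR_right inner_scaleR_left)
  ultimately show ?case
    using ortho eig x_eig
    by (intro exI[of _ "u(k := x)"] exI[of _ "d(k := t)"]) (auto simp: less_Suc_eq)
qed

section \<open>Matrices and their adjoints\<close>

lemma conj_transpose_dim [simp]:
  "dim_row (conj_transpose X) = dim_col X" "dim_col (conj_transpose X) = dim_row X"
  by (simp_all add: conj_transpose_def)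

lemma conj_transpose_carrier [simp]:
  "conj_transpose X \<in> carrier_mat n m \<longleftrightarrow> X \<in> carrier_mat m n"
  unfolding carrier_mat_def by auto

lemma conj_transpose_index [simp]:
  "i < dim_col X \<Longrightarrow> j < dim_row X \<Longrightarrow> conj_transpose X $$ (i, j) = conjugate (X $$ (j, i))"
  by (simp add: conj_transpose_def)

lemma conj_transpose_conj_transpose [simp]: "conj_transpose (conj_transpose X) = X"
  by (rule eq_matI) simp_all

lemma mat_diag_dims [simp]: "dim_row (mat_diag n f) = n" "dim_col (mat_diag n f) = n"
  by (simp_all add: mat_diag_def)

lemma mult_mat_entry:
  assumes "X \<in> carrier_mat n m" "Y \<in> carrier_mat m l" "i < n" "j < l"
  shows "(X * Y) $$ (i, j) = (\<Sum>k<m. X $$ (i, k) * Y $$ (k, j))"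
  using assms by (simp add: scalar_prod_def atLeast0LessThan)

lemma conj_transpose_mult:
  fixes X :: "'a::star_division mat"
  assumes "X \<in> carrier_mat n m" "Y \<in> carrier_mat m l"
  shows "conj_transpose (X * Y) = conj_transpose Y * conj_transpose X"
proof (rule eq_matI)
  fix i j assume "i < dim_row (conj_transpose Y * conj_transpose X)"
    "j < dim_col (conj_transpose Y * conj_transpose X)"
  then have ij: "i < l" "j < n" using assms by auto
  then show "conj_transpose (X * Y) $$ (i, j) = (conj_transpose Y * conj_transpose X) $$ (i, j)"
    using assms mult_mat_entry[OF assms ij(2) ij(1)]
      mult_mat_entry[of "conj_transpose Y" l m "conj_transpose X" n i j]
    by (simp add: star_conjugate_sum conjugate_mult)
qed (use assms in auto)

lemma conj_transpose_diag [simp]: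
  "conj_transpose (mat_diag n (\<lambda>i. of_real (d i) :: 'a::star_division)) = mat_diag n (\<lambda>i. of_real (d i))"
  by (rule eq_matI) (auto simp: mat_diag_def)

lemma square_mult_assoc:
  assumes "A \<in> carrier_mat n n" "B \<in> carrier_mat n n" "C \<in> carrier_mat n n"
  shows "A * B * C = A * (B * C)"
  using assms by (rule assoc_mult_mat)

lemma square_mult_carrier [simp]:
  "A \<in> carrier_mat n n \<Longrightarrow> B \<in> carrier_mat n n \<Longrightarrow> A * B \<in> carrier_mat n n"
  by simp

lemma square_mult_cancel:
  fixes P :: "'a::semiring_1 mat"
  assumes "P * Q = 1\<^sub>m n" "P \<in> carrier_mat n n" "Q \<in> carrier_mat n n" "R \<in> carrier_mat n n"
  shows "P * (Q * R) = R"
  using assms by (simp flip: square_mult_assoc[of P n Q R])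

lemma diag_trace_gram:
  fixes X :: "'a::star_division mat"
  assumes "X \<in> carrier_mat n n"
  shows "(\<Sum>j<n. real_part ((conj_transpose X * X) $$ (j, j))) = (\<Sum>i<n. \<Sum>j<n. normsq (X $$ (i, j)))"
    and "(\<Sum>j<n. real_part ((X * conj_transpose X) $$ (j, j))) = (\<Sum>i<n. \<Sum>j<n. normsq (X $$ (i, j)))"
proof -
  have "(\<Sum>j<n. real_part ((conj_transpose X * X) $$ (j, j))) = (\<Sum>j<n. \<Sum>i<n. normsq (X $$ (i, j)))"
    using assms by (intro sum.cong refl)
      (simp add: mult_mat_entry[of _ n n _ n] real_part_sum conjugate_mult_self del: index_mult_mat)
  then show "(\<Sum>j<n. real_part ((conj_transpose X * X) $$ (j, j))) = (\<Sum>i<n. \<Sum>j<n. normsq (X $$ (i, j)))"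
    by (subst sum.swap)
  show "(\<Sum>j<n. real_part ((X * conj_transpose X) $$ (j, j))) = (\<Sum>i<n. \<Sum>j<n. normsq (X $$ (i, j)))"
    using assms by (intro sum.cong refl)
      (simp add: mult_mat_entry[of _ n n _ n] real_part_sum mult_conjugate_self del: index_mult_mat)
qed

text \<open>The matrix \<open>P = 1 - U\<^sup>* U\<close> is a self-adjoint idempotent, so the sum of the \<open>|P\<^sub>i\<^sub>j|\<^sup>2\<close>, which is the real trace of
  \<open>P\<^sup>* P\<close>, is the real trace of \<open>P\<close>. That trace is \<open>n - n = 0\<close>, since \<open>U\<^sup>* U\<close> and \<open>U U\<^sup>*\<close> have the same real
  trace, the sum of the \<open>|U\<^sub>i\<^sub>j|\<^sup>2\<close>.\<close>

lemma unitary_left_inverse: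
  fixes U :: "'a::star_division mat"
  assumes U: "U \<in> carrier_mat n n" and UU: "U * conj_transpose U = 1\<^sub>m n"
  shows "conj_transpose U * U = 1\<^sub>m n"
proof -
  define Q where "Q = conj_transpose U * U"
  define P where "P = 1\<^sub>m n - Q"
  have Q: "Q \<in> carrier_mat n n" using U by (simp add: Q_def)
  have P: "P \<in> carrier_mat n n" using Q by (simp add: P_def minus_carrier_mat)
  have "Q * Q = Q"
    using U by (simp add: Q_def square_mult_assoc[of _ n] square_mult_cancel[OF UU])
  have "P * P = 1\<^sub>m n * P - Q * P"
    unfolding P_def by (rule minus_mult_distrib_mat) (use Q in \<open>auto simp: minus_carrier_mat\<close>)
  also have "Q * P = Q * 1\<^sub>m n - Q * Q"
    unfolding P_def by (rule mult_minus_distrib_mat) (use Q in auto)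
  also have "\<dots> = 0\<^sub>m n n"
    using Q \<open>Q * Q = Q\<close> by simp
  also have "1\<^sub>m n * P - 0\<^sub>m n n = P"
    using P by (intro eq_matI) auto
  finally have "P * P = P" .
  moreover have "conj_transpose P = P"
  proof -
    have "conj_transpose Q = Q" using U by (simp add: Q_def conj_transpose_mult[of _ n n _ n])
    then have "conjugate (Q $$ (i, j)) = Q $$ (j, i)" if "i < n" "j < n" for i j
      using conj_transpose_index[of j Q i] that Q by simp
    then show ?thesis using Q by (intro eq_matI) (auto simp: P_def)
  qed
  ultimately have "(\<Sum>i<n. \<Sum>j<n. normsq (P $$ (i, j))) = (\<Sum>j<n. real_part (P $$ (j, j)))"
    using diag_trace_gram(1)[OF P] by simp
  also have "\<dots> = real n - (\<Sum>j<n. real_part (Q $$ (j, j)))"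
    using Q by (simp add: P_def sum_subtractf)
  also have "(\<Sum>j<n. real_part (Q $$ (j, j))) = (\<Sum>j<n. real_part ((1\<^sub>m n :: 'a mat) $$ (j, j)))"
    unfolding Q_def diag_trace_gram(1)[OF U] diag_trace_gram(2)[OF U, symmetric] UU ..
  finally have "(\<Sum>i<n. \<Sum>j<n. normsq (P $$ (i, j))) = 0" by simp
  then have "P $$ (i, j) = 0" if "i < n" "j < n" for i j
    using that by (auto simp: sum_nonneg_eq_0_iff sum_nonneg)
  then have "Q = 1\<^sub>m n"
    using Q by (intro eq_matI) (auto simp: P_def)
  then show ?thesis by (simp add: Q_def)
qed

lemma quad_form_inner:
  fixes X :: "'a::star_division mat"
  assumes "X \<in> carrier_mat n n" "v \<in> carrier_vec n"
  shows "quad_form X v = inner n (\<lambda>i. v $ i) (mat_app n (\<lambda>i j. X $$ (i, j)) (\<lambda>i. v $ i))"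
  using assms
  by (auto simp: quad_form_def inner_def mat_app_def scalar_prod_def atLeast0LessThan intro!: sum.cong)

lemma self_adjoint_hermitian:
  assumes "X \<in> carrier_mat n n"
  shows "self_adjoint X \<longleftrightarrow> hermitian n (\<lambda>i j. X $$ (i, j))"
proof
  assume "self_adjoint X"
  then have adj: "conj_transpose X = X" by (simp add: self_adjoint_def)
  show "hermitian n (\<lambda>i j. X $$ (i, j))"
    unfolding hermitian_def
  proof (intro allI impI)
    fix i j assume "i < n" "j < n"
    then show "conjugate (X $$ (i, j)) = X $$ (j, i)"
      using assms conj_transpose_index[of j X i] unfolding adj by simp
  qed
next
  assume "hermitian n (\<lambda>i j. X $$ (i, j))"
  then have "conj_transpose X = X"
    using assms by (intro eq_matI) (auto simp: hermitian_def)
  then show "self_adjoint X" using assms by (simp add: self_adjoint_def)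
qed

lemma quad_form_real:
  fixes X :: "'a::star_division mat"
  assumes "X \<in> carrier_mat n n" "self_adjoint X" "v \<in> carrier_vec n"
  shows "quad_form X v = of_real (real_part (quad_form X v))"
proof -
  have "hermitian n (\<lambda>i j. X $$ (i, j))" using assms by (simp add: self_adjoint_hermitian)
  then show ?thesis
    unfolding quad_form_inner[OF assms(1,3)]
    by (intro of_real_real_part_self_conjugate[symmetric]) (simp add: conjugate_inner inner_mat_app_hermitian)
qed

lemma pos_def_mats_iff:
  fixes X :: "'a::star_division mat"
  shows "X \<in> pos_def_mats n \<longleftrightarrow> X \<in> carrier_mat n n \<and> self_adjoint X \<and>
    (\<forall>v\<in>carrier_vec n. v \<noteq> 0\<^sub>v n \<longrightarrow> real_part (quad_form X v) > 0)"
  unfolding pos_def_mats_def using quad_form_real[of X n] by fastforce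

lemma pos_semidef_mats_iff:
  fixes X :: "'a::star_division mat"
  shows "X \<in> pos_semidef_mats n \<longleftrightarrow> X \<in> carrier_mat n n \<and> self_adjoint X \<and>
    (\<forall>v\<in>carrier_vec n. real_part (quad_form X v) \<ge> 0)"
  unfolding pos_semidef_mats_def using quad_form_real[of X n] by fastforce

lemma conjugate_scalar_prod_adjoint:
  fixes T :: "'a::star_division mat"
  assumes T: "T \<in> carrier_mat n m" and v: "v \<in> carrier_vec m" and w: "w \<in> carrier_vec n"
  shows "conjugate v \<bullet> (conj_transpose T *\<^sub>v w) = conjugate (T *\<^sub>v v) \<bullet> w"
proof -
  have "conjugate v \<bullet> (conj_transpose T *\<^sub>v w) = (\<Sum>i<m. \<Sum>j<n. conjugate (v $ i) * conjugate (T $$ (j, i)) * w $ j)"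
    using assms by (simp add: scalar_prod_def atLeast0LessThan sum_distrib_left mult.assoc)
  also have "\<dots> = (\<Sum>j<n. \<Sum>i<m. conjugate (v $ i) * conjugate (T $$ (j, i)) * w $ j)"
    by (rule sum.swap)
  also have "\<dots> = conjugate (T *\<^sub>v v) \<bullet> w"
    using assms
    by (simp add: scalar_prod_def atLeast0LessThan sum_distrib_right star_conjugate_sum conjugate_mult)
  finally show ?thesis .
qed

lemma pos_def_congruence:
  fixes X :: "'a::star_division mat"
  assumes X: "X \<in> pos_def_mats n" and T: "T \<in> carrier_mat n n" and S: "S \<in> carrier_mat n n"
    and ST: "S * T = 1\<^sub>m n"
  shows "conj_transpose T * X * T \<in> pos_def_mats n"
  unfolding pos_def_mats_iff
proof (intro conjI ballI impI)
  have Xc: "X \<in> carrier_mat n n" and Xs: "conj_transpose X = X"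
    using X by (simp_all add: pos_def_mats_def self_adjoint_def)
  show "conj_transpose T * X * T \<in> carrier_mat n n" using T Xc by simp
  show "self_adjoint (conj_transpose T * X * T)"
    using T Xc by (simp add: self_adjoint_def conj_transpose_mult[of _ n n _ n] Xs square_mult_assoc[of _ n])
  fix v :: "'a vec" assume v: "v \<in> carrier_vec n" "v \<noteq> 0\<^sub>v n"
  have "T *\<^sub>v v \<noteq> 0\<^sub>v n"
  proof
    assume "T *\<^sub>v v = 0\<^sub>v n"
    then have "S * T *\<^sub>v v = S *\<^sub>v 0\<^sub>v n" using S T v by (simp add: assoc_mult_mat_vec[of S n n T n])
    moreover have "S *\<^sub>v 0\<^sub>v n = 0\<^sub>v n" using S by (intro eq_vecI) auto
    ultimately show False using v by (simp add: ST)
  qed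
  moreover have "quad_form (conj_transpose T * X * T) v = quad_form X (T *\<^sub>v v)"
    using conjugate_scalar_prod_adjoint[OF T v(1), of "X *\<^sub>v (T *\<^sub>v v)"] T Xc v(1)
    by (simp add: quad_form_def assoc_mult_mat_vec[of _ n n _ n] square_mult_assoc[of _ n])
  ultimately show "real_part (quad_form (conj_transpose T * X * T) v) > 0"
    using X T v(1) by (simp add: pos_def_mats_iff)
qed

lemma pos_def_diag:
  assumes "\<And>i. i < n \<Longrightarrow> d i > 0"
  shows "mat_diag n (\<lambda>i. of_real (d i) :: 'a::star_division) \<in> pos_def_mats n"
  unfolding pos_def_mats_iff
proof (intro conjI ballI impI)
  let ?D = "mat_diag n (\<lambda>i. of_real (d i) :: 'a)"
  show D: "?D \<in> carrier_mat n n" by simp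
  show "self_adjoint ?D" using carrier_matD[OF D] by (simp add: self_adjoint_def)
  fix v :: "'a vec" assume v: "v \<in> carrier_vec n" "v \<noteq> 0\<^sub>v n"
  have "inner n (\<lambda>i. v $ i) (mat_app n (\<lambda>i j. ?D $$ (i, j)) (\<lambda>i. v $ i))
      = (\<Sum>i<n. d i *\<^sub>R (conjugate (v $ i) * v $ i))"
    unfolding inner_def mat_app_def
    by (intro sum.cong refl)
      (simp add: mat_diag_def if_distribR if_distrib scaleR_conv_of_real[symmetric] cong: if_cong)
  then have eq: "real_part (quad_form ?D v) = (\<Sum>i<n. d i * normsq (v $ i))"
    by (simp add: quad_form_inner[OF D v(1)] real_part_sum normsq_def)
  obtain i where i: "i < n" "v $ i \<noteq> 0"
    using v by (metis eq_vecI carrier_vecD index_zero_vec)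
  have "0 < d i * normsq (v $ i)"
    using i assms[of i] normsq_nonneg[of "v $ i"] by (simp add: less_le)
  also have "\<dots> \<le> (\<Sum>i<n. d i * normsq (v $ i))"
    using i assms by (intro member_le_sum) (auto simp: less_imp_le)
  finally show "real_part (quad_form ?D v) > 0" by (simp add: eq)
qed

lemma pos_defD:
  assumes "X \<in> pos_def_mats n"
  shows "X \<in> carrier_mat n n" "conj_transpose X = X"
  using assms by (simp_all add: pos_def_mats_def self_adjoint_def)

section \<open>Spectral theorem and functional calculus\<close>

lemma spectral_theorem:
  fixes X :: "'a::star_division mat"
  assumes X: "X \<in> pos_def_mats n"
  shows "\<exists>U d. diagonalizes U d X"
proof -
  have Xc: "X \<in> carrier_mat n n" and "self_adjoint X"
    using X by (simp_all add: pos_def_mats_def)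
  then have herm: "hermitian n (\<lambda>i j. X $$ (i, j))" by (simp add: self_adjoint_hermitian)
  obtain u d where ortho: "\<And>a b. a < n \<Longrightarrow> b < n \<Longrightarrow> inner n (u a) (u b) = (if a = b then 1 else 0)"
    and eig: "\<And>a i. a < n \<Longrightarrow> i < n \<Longrightarrow> mat_app n (\<lambda>i j. X $$ (i, j)) (u a) i = d a *\<^sub>R u a i"
    using hermitian_orthonormal_eigenvectors[OF herm order_refl] by blast
  define U where "U = mat n n (\<lambda>(i, a). u a i)"
  define D where "D = mat_diag n (\<lambda>i. of_real (d i) :: 'a)"
  have U: "U \<in> carrier_mat n n" by (simp add: U_def)
  have D: "D \<in> carrier_mat n n" by (simp add: D_def)
  have "conj_transpose U * U = 1\<^sub>m n"
    by (rule eq_matI) (auto simp: U_def scalar_prod_def atLeast0LessThan ortho simp flip: inner_def)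
  then have UU: "U * conj_transpose U = 1\<^sub>m n"
    using unitary_left_inverse[of "conj_transpose U" n] U by simp
  have "X * U = U * D"
  proof (rule eq_matI)
    fix i a assume "i < dim_row (U * D)" "a < dim_col (U * D)"
    then have ia: "i < n" "a < n" by (simp_all add: U_def D_def mat_diag_def)
    have "(X * U) $$ (i, a) = d a *\<^sub>R u a i"
      using Xc ia eig[OF ia(2,1)] by (simp add: U_def scalar_prod_def atLeast0LessThan mat_app_def)
    moreover have "(U * D) $$ (i, a) = u a i * of_real (d a)"
      using ia unfolding D_def mat_diag_mult_right[OF U] by (simp add: U_def)
    ultimately show "(X * U) $$ (i, a) = (U * D) $$ (i, a)" by (simp add: of_real_def)
  qed (use Xc in \<open>auto simp: U_def D_def mat_diag_def\<close>)
  then have "U * D * conj_transpose U = X * (U * conj_transpose U)"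
    using Xc U by (simp flip: square_mult_assoc[of X n])
  then have "X = U * D * conj_transpose U" using Xc by (simp add: UU)
  moreover have "d a > 0" if "a < n" for a
  proof -
    define v where "v = vec n (u a)"
    have v: "v \<in> carrier_vec n" by (simp add: v_def)
    have nz: "v \<noteq> 0\<^sub>v n"
    proof
      assume "v = 0\<^sub>v n"
      then have "u a i = 0" if "i < n" for i using that by (metis v_def index_vec index_zero_vec(1))
      then have "inner n (u a) (u a) = 0" by (simp add: inner_def)
      then show False using ortho[OF that that] by simp
    qed
    have "quad_form X v = inner n (u a) (mat_app n (\<lambda>i j. X $$ (i, j)) (u a))"
      unfolding quad_form_inner[OF Xc v] by (simp add: inner_def mat_app_def v_def)
    also have "\<dots> = inner n (u a) (\<lambda>i. d a *\<^sub>R u a i)"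
      by (rule inner_cong) (simp_all add: eig that)
    also have "\<dots> = of_real (d a)"
      using ortho[OF that that] by (simp add: inner_scaleR_right of_real_def)
    finally have "real_part (quad_form X v) = d a" by simp
    moreover have "real_part (quad_form X v) > 0" using X v nz by (simp add: pos_def_mats_iff)
    ultimately show ?thesis by simp
  qed
  ultimately show ?thesis
    using Xc U UU unfolding diagonalizes_def D_def by auto
qed

lemma diagonalizesD:
  fixes X :: "'a::star_division mat"
  assumes "diagonalizes U d X" "X \<in> carrier_mat n n"
  shows "U \<in> carrier_mat n n" "U * conj_transpose U = 1\<^sub>m n" "conj_transpose U * U = 1\<^sub>m n"
    "\<And>i. i < n \<Longrightarrow> d i > 0" "X = U * mat_diag n (\<lambda>i. of_real (d i)) * conj_transpose U"
  using assms unitary_left_inverse[of U n] by (auto simp: diagonalizes_def)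

lemma unitary_conj_diag_pos_def:
  fixes U :: "'a::star_division mat"
  assumes U: "U \<in> carrier_mat n n" "U * conj_transpose U = 1\<^sub>m n" and "\<And>i. i < n \<Longrightarrow> d i > 0"
  shows "U * mat_diag n (\<lambda>i. of_real (d i)) * conj_transpose U \<in> pos_def_mats n"
  using pos_def_congruence[OF pos_def_diag, of n d "conj_transpose U" U] assms by simp

text \<open>The matrix \<open>W = V\<^sup>* U\<close> intertwines the two diagonal matrices, so \<open>W\<^sub>i\<^sub>j\<close> vanishes unless \<open>d\<^sub>j = e\<^sub>i\<close>.
  Then \<open>W\<close> also intertwines the matrices obtained by applying \<open>g\<close>.\<close>

lemma functional_calculus_unique:
  fixes X :: "'a::star_division mat"
  assumes Xc: "X \<in> carrier_mat n n" and Ud: "diagonalizes U d X" and Ve: "diagonalizes V e X"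
  shows "U * mat_diag n (\<lambda>i. of_real (g (d i))) * conj_transpose U
    = V * mat_diag n (\<lambda>i. of_real (g (e i))) * conj_transpose V"
proof -
  note U = diagonalizesD[OF Ud Xc] and V = diagonalizesD[OF Ve Xc]
  define D E where "D = mat_diag n (\<lambda>i. of_real (d i) :: 'a)" and "E = mat_diag n (\<lambda>i. of_real (e i) :: 'a)"
  define D' E' where "D' = mat_diag n (\<lambda>i. of_real (g (d i)) :: 'a)"
    and "E' = mat_diag n (\<lambda>i. of_real (g (e i)) :: 'a)"
  define W where "W = conj_transpose V * U"
  have c [simp]: "D \<in> carrier_mat n n" "E \<in> carrier_mat n n" "D' \<in> carrier_mat n n" "E' \<in> carrier_mat n n"
    "W \<in> carrier_mat n n" "U \<in> carrier_mat n n" "V \<in> carrier_mat n n"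
    using U(1) V(1) by (simp_all add: D_def E_def D'_def E'_def W_def)
  note assoc = square_mult_assoc[of _ n]
  have "X * U = U * D"
    by (subst U(5)) (simp add: assoc U(3) D_def)
  moreover have "conj_transpose V * X = E * conj_transpose V"
    by (subst V(5)) (simp add: assoc square_mult_cancel[OF V(3)] flip: E_def)
  ultimately have WD: "W * D = E * W"
    using Xc unfolding W_def by (metis assoc c conj_transpose_carrier)
  have entry: "W $$ (i, j) * of_real (g (d j)) = of_real (g (e i)) * W $$ (i, j)" if "i < n" "j < n" for i j
  proof -
    have "W $$ (i, j) * of_real (d j) = of_real (e i) * W $$ (i, j)"
      using arg_cong[OF WD, of "\<lambda>M. M $$ (i, j)"] that
      unfolding D_def E_def mat_diag_mult_right[OF c(5)] mat_diag_mult_left[OF c(5)] by simp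
    then have "(d j - e i) *\<^sub>R W $$ (i, j) = 0"
      by (simp add: of_real_def algebra_simps)
    then show ?thesis by (auto simp: of_real_def)
  qed
  have "W * D' = E' * W"
    unfolding D'_def E'_def mat_diag_mult_right[OF c(5)] mat_diag_mult_left[OF c(5)]
    by (rule eq_matI) (simp_all add: entry)
  moreover have "U * D' * conj_transpose U = V * (W * D') * conj_transpose U"
    by (simp add: W_def assoc square_mult_cancel[OF V(2)])
  ultimately have "U * D' * conj_transpose U = V * (E' * (conj_transpose V * (U * conj_transpose U)))"
    by (simp add: assoc W_def)
  then show ?thesis unfolding U(2) by (simp add: assoc right_mult_one_mat[of _ n n] flip: D'_def E'_def)
qed

lemma fun_calc_diagonalizes:
  fixes X :: "'a::star_division mat"
  assumes Xc: "X \<in> carrier_mat n n" and Ud: "diagonalizes U d X"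
  shows "fun_calc g X = U * mat_diag n (\<lambda>i. of_real (g (d i))) * conj_transpose U"
  unfolding fun_calc_def carrier_matD(1)[OF Xc]
proof (rule the_equality)
  show "\<exists>V e. diagonalizes V e X \<and> U * mat_diag n (\<lambda>i. of_real (g (d i))) * conj_transpose U
    = V * mat_diag n (\<lambda>i. of_real (g (e i))) * conj_transpose V"
    using Ud by blast
next
  fix Y assume "\<exists>V e. diagonalizes V e X \<and> Y = V * mat_diag n (\<lambda>i. of_real (g (e i))) * conj_transpose V"
  then show "Y = U * mat_diag n (\<lambda>i. of_real (g (d i))) * conj_transpose U"
    using functional_calculus_unique[OF Xc _ Ud] by metis
qed

lemma diagonalizes_fun_calc:
  fixes X :: "'a::star_division mat"
  assumes Xc: "X \<in> carrier_mat n n" and Ud: "diagonalizes U d X" and g: "\<And>x. x > 0 \<Longrightarrow> g x > 0"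
  shows "diagonalizes U (\<lambda>i. g (d i)) (fun_calc g X)"
proof -
  note U = diagonalizesD[OF Ud Xc] and eq = fun_calc_diagonalizes[OF Xc Ud, of g]
  have "dim_row (fun_calc g X) = n" using U(1) by (simp add: eq)
  then show ?thesis using U(1,2,4) eq g by (simp add: diagonalizes_def)
qed

lemma fun_calc_pos_def:
  fixes X :: "'a::star_division mat"
  assumes X: "X \<in> pos_def_mats n" and g: "\<And>x. x > 0 \<Longrightarrow> g x > 0"
  shows "fun_calc g X \<in> pos_def_mats n"
proof -
  note Xc = pos_defD(1)[OF X]
  obtain U d where Ud: "diagonalizes U d X" using spectral_theorem[OF X] by blast
  show ?thesis
    unfolding fun_calc_diagonalizes[OF Xc Ud]
    by (intro unitary_conj_diag_pos_def g diagonalizesD[OF Ud Xc])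
qed

lemma fun_calc_mult:
  fixes X :: "'a::star_division mat"
  assumes X: "X \<in> pos_def_mats n"
  shows "fun_calc f X * fun_calc g X = fun_calc (\<lambda>x. f x * g x) X"
proof -
  note Xc = pos_defD(1)[OF X]
  obtain U d where Ud: "diagonalizes U d X" using spectral_theorem[OF X] by blast
  note U = diagonalizesD[OF Ud Xc]
  have diag: "mat_diag n F * (mat_diag n G * R) = mat_diag n (\<lambda>i. F i * G i) * R"
    if "R \<in> carrier_mat n n" for F G :: "nat \<Rightarrow> 'a" and R
    using that by (simp flip: square_mult_assoc[of _ n])
  show ?thesis
    unfolding fun_calc_diagonalizes[OF Xc Ud]
    using U(1) by (simp add: square_mult_assoc[of _ n] square_mult_cancel[OF U(3)] diag)
qed

lemma fun_calc_cong:
  fixes X :: "'a::star_division mat"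
  assumes X: "X \<in> pos_def_mats n" and "\<And>x. x > 0 \<Longrightarrow> f x = g x"
  shows "fun_calc f X = fun_calc g X"
proof -
  note Xc = pos_defD(1)[OF X]
  obtain U d where Ud: "diagonalizes U d X" using spectral_theorem[OF X] by blast
  have "mat_diag n (\<lambda>i. of_real (f (d i)) :: 'a) = mat_diag n (\<lambda>i. of_real (g (d i)))"
    using diagonalizesD(4)[OF Ud Xc] assms(2) by (intro eq_matI) (auto simp: mat_diag_def)
  then show ?thesis unfolding fun_calc_diagonalizes[OF Xc Ud] by simp
qed

lemma fun_calc_id:
  fixes X :: "'a::star_division mat"
  assumes X: "X \<in> pos_def_mats n"
  shows "fun_calc (\<lambda>x. x) X = X"
proof -
  note Xc = pos_defD(1)[OF X]
  obtain U d where Ud: "diagonalizes U d X" using spectral_theorem[OF X] by blast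
  show ?thesis
    unfolding fun_calc_diagonalizes[OF Xc Ud] using diagonalizesD(5)[OF Ud Xc] by (rule sym)
qed

lemma fun_calc_one:
  fixes X :: "'a::star_division mat"
  assumes X: "X \<in> pos_def_mats n"
  shows "fun_calc (\<lambda>_. 1) X = 1\<^sub>m n"
proof -
  note Xc = pos_defD(1)[OF X]
  obtain U d where Ud: "diagonalizes U d X" using spectral_theorem[OF X] by blast
  show ?thesis
    using diagonalizesD(1,2)[OF Ud Xc] by (simp add: fun_calc_diagonalizes[OF Xc Ud])
qed

lemma fun_calc_comp:
  fixes X :: "'a::star_division mat"
  assumes X: "X \<in> pos_def_mats n" and g: "\<And>x. x > 0 \<Longrightarrow> g x > 0"
  shows "fun_calc f (fun_calc g X) = fun_calc (\<lambda>x. f (g x)) X"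
proof -
  note Xc = pos_defD(1)[OF X]
  obtain U d where Ud: "diagonalizes U d X" using spectral_theorem[OF X] by blast
  show ?thesis
    using fun_calc_diagonalizes[OF pos_defD(1)[OF fun_calc_pos_def[OF X g]] diagonalizes_fun_calc[OF Xc Ud g]]
    by (simp add: fun_calc_diagonalizes[OF Xc Ud])
qed

text \<open>If \<open>w\<close> are the coordinates of an eigenvector for \<open>\<mu>\<close>, then \<open>d\<^sub>i w\<^sub>i = w\<^sub>i \<mu>\<close>. As \<open>d\<^sub>i\<close> is real it
  commutes with \<open>w\<^sub>i\<close>, which can be cancelled for some \<open>i\<close>.\<close>

lemma spec_diagonalizes:
  fixes X :: "'a::star_division mat"
  assumes Xc: "X \<in> carrier_mat n n" and Ud: "diagonalizes U d X"
  shows "spec X \<subseteq> (\<lambda>i. of_real (d i)) ` {..<n}"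
proof
  fix \<mu> assume "\<mu> \<in> spec X"
  then obtain v where v: "v \<in> carrier_vec n" "v \<noteq> 0\<^sub>v n" and eig: "X *\<^sub>v v = map_vec (\<lambda>x. x * \<mu>) v"
    using Xc by (auto simp: spec_def)
  note U = diagonalizesD[OF Ud Xc]
  define w where "w = conj_transpose U *\<^sub>v v"
  have Uc: "conj_transpose U \<in> carrier_mat n n" using U(1) by simp
  have w: "w \<in> carrier_vec n" using U(1) v by (simp add: w_def)
  have Uw: "U *\<^sub>v w = v"
    unfolding w_def assoc_mult_mat_vec[OF U(1) Uc v(1), symmetric] U(2) using v by simp
  have "w \<noteq> 0\<^sub>v n"
  proof
    assume "w = 0\<^sub>v n"
    then have "v = 0\<^sub>v n" using Uw U(1) by auto
    with v(2) show False by simp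
  qed
  then obtain i where i: "i < n" "w $ i \<noteq> 0"
    using w by (metis eq_vecI carrier_vecD index_zero_vec)
  let ?D = "mat_diag n (\<lambda>i. of_real (d i) :: 'a)"
  have "conj_transpose U * X = ?D * conj_transpose U"
    by (subst U(5)) (use U(1) in \<open>simp add: square_mult_assoc[of _ n] square_mult_cancel[OF U(3)]\<close>)
  then have "conj_transpose U *\<^sub>v (X *\<^sub>v v) = ?D *\<^sub>v w"
    using assoc_mult_mat_vec[OF Uc Xc v(1)] assoc_mult_mat_vec[OF _ Uc v(1), of ?D n]
    by (simp add: w_def)
  then have "(conj_transpose U *\<^sub>v map_vec (\<lambda>x. x * \<mu>) v) $ i = (?D *\<^sub>v w) $ i" by (simp add: eig)
  moreover have "(conj_transpose U *\<^sub>v map_vec (\<lambda>x. x * \<mu>) v) $ i = w $ i * \<mu>"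
    using i U(1) v by (simp add: w_def scalar_prod_def sum_distrib_right mult.assoc)
  moreover have "(?D *\<^sub>v w) $ i = of_real (d i) * w $ i"
    using i w by (simp add: scalar_prod_def mat_diag_def if_distribR if_distrib cong: if_cong)
  ultimately have "w $ i * \<mu> = w $ i * of_real (d i)"
    by (simp add: real_scalar_commute)
  then show "\<mu> \<in> (\<lambda>i. of_real (d i)) ` {..<n}" using i by auto
qed

section \<open>The geometric mean\<close>

text \<open>With \<open>S = A\<^bsup>1/2\<^esup>\<close> and \<open>G = S\<^sup>-\<^sup>1\<close> one has \<open>C = G M G\<close> for \<open>M = (S B S)\<^bsup>1/2\<^esup>\<close>, whence
  \<open>C A C = G M G S S G M G = G M\<^sup>2 G = B\<close>.\<close>

lemma geom_mean_inverse_pos_def: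
  fixes A :: "'a::star_division mat"
  assumes A: "A \<in> pos_def_mats n" and B: "B \<in> pos_def_mats n"
  defines "C \<equiv> geom_mean (mat_powr A (-1)) B"
  shows "C \<in> pos_def_mats n" and "C * A * C = B"
proof -
  define G S where "G = fun_calc (\<lambda>x. x powr (-1/2)) A" and "S = fun_calc (\<lambda>x. x powr (1/2)) A"
  have powr_powr_A: "mat_powr (mat_powr A (-1)) t = fun_calc (\<lambda>x. x powr (- t)) A" for t
  proof -
    have "mat_powr (mat_powr A (-1)) t = fun_calc (\<lambda>x. (x powr (-1)) powr t) A"
      unfolding mat_powr_def by (rule fun_calc_comp[OF A]) simp
    then show ?thesis by (simp only: powr_powr) simp
  qed
  have Geq: "mat_powr (mat_powr A (-1)) (1/2) = G" and Seq: "mat_powr (mat_powr A (-1)) (-1/2) = S"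
    unfolding powr_powr_A G_def S_def by simp_all
  have Gp: "G \<in> pos_def_mats n" and Sp: "S \<in> pos_def_mats n"
    unfolding G_def S_def by (auto intro: fun_calc_pos_def[OF A])
  have GS: "G * S = 1\<^sub>m n" and SG: "S * G = 1\<^sub>m n"
    unfolding G_def S_def fun_calc_mult[OF A] fun_calc_one[OF A, symmetric]
    by (rule fun_calc_cong[OF A]; simp flip: powr_add)+
  have SS: "S * S = A"
  proof -
    have "S * S = fun_calc (\<lambda>x. x) A"
      unfolding S_def fun_calc_mult[OF A] by (rule fun_calc_cong[OF A]) (simp flip: powr_add)
    then show ?thesis by (simp add: fun_calc_id[OF A])
  qed
  note c [simp] = pos_defD(1)[OF A] pos_defD(1)[OF B] pos_defD(1)[OF Gp] pos_defD(1)[OF Sp]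
  have SBS: "S * B * S \<in> pos_def_mats n"
    using pos_def_congruence[OF B c(4) c(3) GS] by (simp add: pos_defD(2)[OF Sp])
  define M where "M = mat_powr (S * B * S) (1/2)"
  have Mp: "M \<in> pos_def_mats n"
    unfolding M_def mat_powr_def by (rule fun_calc_pos_def[OF SBS]) simp
  note Mc [simp] = pos_defD(1)[OF Mp]
  have MM: "M * M = S * B * S"
  proof -
    have "M * M = fun_calc (\<lambda>x. x) (S * B * S)"
      unfolding M_def mat_powr_def fun_calc_mult[OF SBS]
      by (rule fun_calc_cong[OF SBS]) (simp flip: powr_add)
    then show ?thesis by (simp add: fun_calc_id[OF SBS])
  qed
  have C: "C = G * M * G"
    unfolding C_def geom_mean_def Geq Seq M_def ..
  show "C \<in> pos_def_mats n"
    using pos_def_congruence[OF Mp c(3) c(4) SG] by (simp add: C pos_defD(2)[OF Gp])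
  have "C * A * C = G * (M * M) * G"
    unfolding C SS[symmetric]
    by (simp add: square_mult_assoc[of _ n] square_mult_cancel[OF GS] square_mult_cancel[OF SG])
  also have "\<dots> = B"
    unfolding MM
    by (simp add: square_mult_assoc[of _ n] square_mult_cancel[OF GS] SG right_mult_one_mat[of _ n n])
  finally show "C * A * C = B" .
qed

section \<open>Scalar consequences of operator monotonicity\<close>

definition sym2 :: "real \<Rightarrow> real \<Rightarrow> real \<Rightarrow> complex mat"
  where "sym2 \<alpha> \<beta> \<gamma> = mat 2 2 (\<lambda>(i, j). of_real (if i = j then if i = 0 then \<alpha> else \<gamma> else \<beta>))"

text \<open>The parameter is the squared sine of the rotation angle.\<close>

definition rot2 :: "real \<Rightarrow> complex mat"
  where "rot2 \<sigma> = mat 2 2 (\<lambda>(i, j). of_real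
    (if i = j then sqrt (1 - \<sigma>) else if i = 0 then - sqrt \<sigma> else sqrt \<sigma>))"

text \<open>The real symmetric matrix with eigenvalues \<open>p\<close> and \<open>q\<close> whose eigenvectors are the columns of
  \<open>rot2 \<sigma>\<close>. For \<open>\<sigma> = 0\<close> it is the diagonal matrix with entries \<open>p\<close>, \<open>q\<close>, so that the test matrices and the
  diagonal matrices they are compared with have the same form.\<close>

definition sym2_spectral :: "real \<Rightarrow> real \<Rightarrow> real \<Rightarrow> complex mat"
  where "sym2_spectral \<sigma> p q = sym2 ((1 - \<sigma>) * p + \<sigma> * q) (sqrt \<sigma> * sqrt (1 - \<sigma>) * (p - q))
    (\<sigma> * p + (1 - \<sigma>) * q)"

lemma sym2_carrier [simp]: "sym2 \<alpha> \<beta> \<gamma> \<in> carrier_mat 2 2"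
  by (simp add: sym2_def)

lemma sym2_minus: "sym2 \<alpha> \<beta> \<gamma> - sym2 \<alpha>' \<beta>' \<gamma>' = sym2 (\<alpha> - \<alpha>') (\<beta> - \<beta>') (\<gamma> - \<gamma>')"
  by (rule eq_matI) (auto simp: sym2_def)

lemma real_part_complex: "real_part z = Re z"
  by (rule real_part_eqI) (simp add: complex_eq_iff)

lemma real_part_quad_form_sym2:
  assumes "v \<in> carrier_vec 2"
  shows "real_part (quad_form (sym2 \<alpha> \<beta> \<gamma>) v) = \<alpha> * (cmod (v $ 0))\<^sup>2 + \<gamma> * (cmod (v $ 1))\<^sup>2
    + 2 * \<beta> * (Re (v $ 0) * Re (v $ 1) + Im (v $ 0) * Im (v $ 1))"
  unfolding cmod_power2 using assms
  by (simp add: quad_form_def scalar_prod_def sym2_def real_part_complex numeral_2_eq_2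
      power2_eq_square algebra_simps)

lemma self_adjoint_sym2: "self_adjoint (sym2 \<alpha> \<beta> \<gamma>)"
  by (subst self_adjoint_hermitian[of _ 2]) (auto simp: hermitian_def sym2_def)

text \<open>Completing the square after multiplying the form by \<open>\<alpha>\<close>.\<close>

lemma sym2_pos_semidef:
  assumes "\<alpha> > 0" "\<beta>\<^sup>2 \<le> \<alpha> * \<gamma>"
  shows "sym2 \<alpha> \<beta> \<gamma> \<in> pos_semidef_mats 2"
  unfolding pos_semidef_mats_iff
proof (intro conjI ballI)
  fix v :: "complex vec" assume v: "v \<in> carrier_vec 2"
  define a b c d where "a = Re (v $ 0)" "b = Im (v $ 0)" "c = Re (v $ 1)" "d = Im (v $ 1)"
  have "\<alpha> * real_part (quad_form (sym2 \<alpha> \<beta> \<gamma>) v)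
      = (\<alpha> * a + \<beta> * c)\<^sup>2 + (\<alpha> * b + \<beta> * d)\<^sup>2 + (\<alpha> * \<gamma> - \<beta>\<^sup>2) * (c\<^sup>2 + d\<^sup>2)"
    unfolding real_part_quad_form_sym2[OF v] cmod_power2 a_b_c_d_def
    by (simp add: power2_eq_square algebra_simps)
  also have "\<dots> \<ge> 0" using assms(2) by simp
  finally show "real_part (quad_form (sym2 \<alpha> \<beta> \<gamma>) v) \<ge> 0"
    using assms(1) by (simp add: zero_le_mult_iff)
qed (simp_all add: self_adjoint_sym2)

lemma sym2_pos_semidefD:
  assumes "sym2 \<alpha> \<beta> \<gamma> \<in> pos_semidef_mats 2"
  shows "\<alpha> \<ge> 0" "\<gamma> \<ge> 0"
proof -
  have psd: "real_part (quad_form (sym2 \<alpha> \<beta> \<gamma>) v) \<ge> 0" if "v \<in> carrier_vec 2" for v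
    using assms that by (simp add: pos_semidef_mats_iff)
  show "\<alpha> \<ge> 0" using psd[of "unit_vec 2 0"] by (simp add: real_part_quad_form_sym2)
  show "\<gamma> \<ge> 0" using psd[of "unit_vec 2 1"] by (simp add: real_part_quad_form_sym2)
qed

lemma rot2_diag:
  assumes "0 \<le> \<sigma>" "\<sigma> \<le> 1"
  shows "rot2 \<sigma> * mat_diag 2 (\<lambda>i. of_real (if i = 0 then p else q)) * conj_transpose (rot2 \<sigma>)
    = sym2_spectral \<sigma> p q"
proof -
  have sq: "sqrt \<sigma> * sqrt \<sigma> = \<sigma>" "sqrt (1 - \<sigma>) * sqrt (1 - \<sigma>) = 1 - \<sigma>"
    using assms by auto
  have cases2: "i = 0 \<or> i = 1" if "i < 2" for i :: nat using that by auto
  have R: "rot2 \<sigma> \<in> carrier_mat 2 2" by (simp add: rot2_def)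
  show ?thesis
  proof (rule eq_matI)
    fix i j assume "i < dim_row (sym2_spectral \<sigma> p q)" "j < dim_col (sym2_spectral \<sigma> p q)"
    then have ij: "i < 2" "j < 2" by (simp_all add: sym2_spectral_def sym2_def)
    have "(rot2 \<sigma> * mat_diag 2 (\<lambda>i. of_real (if i = 0 then p else q)) * conj_transpose (rot2 \<sigma>)) $$ (i, j)
        = (\<Sum>k<2. (rot2 \<sigma> $$ (i, k) * of_real (if k = 0 then p else q)) * cnj (rot2 \<sigma> $$ (j, k)))"
      unfolding mat_diag_mult_right[OF R]
      using ij R by (subst mult_mat_entry[of _ 2 2 _ 2]) (auto simp: rot2_def)
    also have "\<dots> = sym2_spectral \<sigma> p q $$ (i, j)"
    proof -
      have sum2: "(\<Sum>k<2::nat. g k) = g 0 + g 1" for g :: "nat \<Rightarrow> complex"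
        by (simp add: numeral_2_eq_2)
      show ?thesis
        unfolding sum2 using cases2[OF ij(1)] cases2[OF ij(2)] sq
        by (elim disjE; simp add: rot2_def sym2_spectral_def sym2_def complex_eq_iff algebra_simps)
    qed
    finally show "(rot2 \<sigma> * mat_diag 2 (\<lambda>i. of_real (if i = 0 then p else q)) * conj_transpose (rot2 \<sigma>)) $$ (i, j)
        = sym2_spectral \<sigma> p q $$ (i, j)" .
  qed (simp_all add: rot2_def sym2_spectral_def sym2_def)
qed

lemma sym2_spectral_diagonalizes:
  assumes "0 \<le> \<sigma>" "\<sigma> \<le> 1" "p > 0" "q > 0"
  shows "diagonalizes (rot2 \<sigma>) (\<lambda>i. if i = 0 then p else q) (sym2_spectral \<sigma> p q)"
proof -
  have R: "rot2 \<sigma> \<in> carrier_mat 2 2" by (simp add: rot2_def)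
  have "mat_diag 2 (\<lambda>i. complex_of_real (if i = 0 then 1 else 1)) = 1\<^sub>m 2"
    by simp
  then have "rot2 \<sigma> * conj_transpose (rot2 \<sigma>) = sym2_spectral \<sigma> 1 1"
    using rot2_diag[OF assms(1,2), of 1 1] R by simp
  also have "\<dots> = 1\<^sub>m 2"
    by (rule eq_matI) (auto simp: sym2_spectral_def sym2_def)
  finally show ?thesis
    using assms R rot2_diag[OF assms(1,2), of p q]
    unfolding diagonalizes_def by (simp add: sym2_spectral_def carrier_matD(1)[OF sym2_carrier])
qed

lemma sym2_spectral_pos_def:
  assumes "0 \<le> \<sigma>" "\<sigma> \<le> 1" "p > 0" "q > 0"
  shows "sym2_spectral \<sigma> p q \<in> pos_def_mats 2"
proof -
  have c: "sym2_spectral \<sigma> p q \<in> carrier_mat 2 2" by (simp add: sym2_spectral_def)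
  note D = diagonalizesD[OF sym2_spectral_diagonalizes[OF assms] c]
  show ?thesis by (subst D(5)) (intro unitary_conj_diag_pos_def D)
qed

lemma fun_calc_sym2_spectral:
  assumes "0 \<le> \<sigma>" "\<sigma> \<le> 1" "p > 0" "q > 0"
  shows "fun_calc h (sym2_spectral \<sigma> p q) = sym2_spectral \<sigma> (h p) (h q)"
proof -
  have c: "sym2_spectral \<sigma> p q \<in> carrier_mat 2 2" by (simp add: sym2_spectral_def)
  show ?thesis
    using fun_calc_diagonalizes[OF c sym2_spectral_diagonalizes[OF assms], of h]
      rot2_diag[OF assms(1,2), of "h p" "h q"]
    by (simp add: if_distrib cong: if_cong)
qed

text \<open>Diagonal entries of a positive semidefinite matrix are nonnegative.\<close>

lemma operator_monotone_2x2:
  assumes h: "operator_monotone h"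
    and 1: "0 \<le> \<sigma>" "\<sigma> \<le> 1" "p > 0" "q > 0" and 2: "0 \<le> \<tau>" "\<tau> \<le> 1" "r > 0" "s > 0"
    and psd: "sym2_spectral \<tau> r s - sym2_spectral \<sigma> p q \<in> pos_semidef_mats 2"
  shows "(1 - \<sigma>) * h p + \<sigma> * h q \<le> (1 - \<tau>) * h r + \<tau> * h s"
    and "\<sigma> * h p + (1 - \<sigma>) * h q \<le> \<tau> * h r + (1 - \<tau>) * h s"
proof -
  have dim: "dim_row (sym2_spectral \<sigma> p q) = 2" for \<sigma> p q
    by (simp add: sym2_spectral_def sym2_def)
  have "loewner_le (sym2_spectral \<sigma> p q) (sym2_spectral \<tau> r s)"
    using psd by (simp add: loewner_le_def dim)
  then have "loewner_le (sym2_spectral \<sigma> (h p) (h q)) (sym2_spectral \<tau> (h r) (h s))"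
    using h sym2_spectral_pos_def[OF 1] sym2_spectral_pos_def[OF 2]
    unfolding operator_monotone_def
    by (metis fun_calc_sym2_spectral[OF 1] fun_calc_sym2_spectral[OF 2])
  then have "sym2_spectral \<tau> (h r) (h s) - sym2_spectral \<sigma> (h p) (h q) \<in> pos_semidef_mats 2"
    by (simp add: loewner_le_def dim)
  then show "(1 - \<sigma>) * h p + \<sigma> * h q \<le> (1 - \<tau>) * h r + \<tau> * h s"
    and "\<sigma> * h p + (1 - \<sigma>) * h q \<le> \<tau> * h r + (1 - \<tau>) * h s"
    unfolding sym2_spectral_def sym2_minus by (auto dest: sym2_pos_semidefD)
qed

text \<open>A strict inequality in the first diagonal entry extends to a Loewner inequality between
  the rotated matrix and a diagonal one, if the second diagonal entry \<open>s\<close> is large enough to make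
  the determinant of the difference nonnegative.\<close>

lemma operator_monotone_upper_diag:
  assumes h: "operator_monotone h" and 1: "0 \<le> \<sigma>" "\<sigma> \<le> 1" "p > 0" "q > 0"
    and r: "(1 - \<sigma>) * p + \<sigma> * q < r"
  shows "(1 - \<sigma>) * h p + \<sigma> * h q \<le> h r"
proof -
  define \<alpha> where "\<alpha> = r - ((1 - \<sigma>) * p + \<sigma> * q)"
  define K where "K = \<sigma> * (1 - \<sigma>) * (p - q)\<^sup>2"
  define s where "s = \<sigma> * p + (1 - \<sigma>) * q + K / \<alpha> + 1"
  have \<alpha>: "\<alpha> > 0" using r by (simp add: \<alpha>_def)
  have s: "s > 0" using 1 \<alpha> by (simp add: s_def K_def add_nonneg_pos)
  have "0 \<le> (1 - \<sigma>) * p + \<sigma> * q" using 1 by simp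
  then have "r > 0" using r by linarith
  have "\<alpha> * (s - (\<sigma> * p + (1 - \<sigma>) * q)) = K + \<alpha>"
    using \<alpha> by (simp add: s_def distrib_left)
  then have "(sqrt \<sigma> * sqrt (1 - \<sigma>) * (p - q))\<^sup>2 \<le> \<alpha> * (s - (\<sigma> * p + (1 - \<sigma>) * q))"
    using 1 \<alpha> by (simp add: power_mult_distrib K_def)
  then have "sym2_spectral 0 r s - sym2_spectral \<sigma> p q \<in> pos_semidef_mats 2"
    unfolding sym2_spectral_def sym2_minus using \<alpha>
    by (intro sym2_pos_semidef) (simp_all add: \<alpha>_def)
  from operator_monotone_2x2(1)[OF h 1 _ _ \<open>r > 0\<close> s this] show ?thesis by simp
qed

lemma operator_monotone_lower_diag:
  assumes h: "operator_monotone h" and 1: "0 \<le> \<sigma>" "\<sigma> \<le> 1" "p > 0" "q > 0" and rs: "r > 0" "s > 0"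
    and r: "r < (1 - \<sigma>) * p + \<sigma> * q"
    and det: "\<sigma> * (1 - \<sigma>) * (p - q)\<^sup>2 \<le> ((1 - \<sigma>) * p + \<sigma> * q - r) * (\<sigma> * p + (1 - \<sigma>) * q - s)"
  shows "h s \<le> \<sigma> * h p + (1 - \<sigma>) * h q"
proof -
  have "(sqrt \<sigma> * sqrt (1 - \<sigma>) * (p - q))\<^sup>2 = \<sigma> * (1 - \<sigma>) * (p - q)\<^sup>2"
    using 1 by (simp add: power_mult_distrib)
  then have "sym2_spectral \<sigma> p q - sym2_spectral 0 r s \<in> pos_semidef_mats 2"
    unfolding sym2_spectral_def sym2_minus using r det
    by (intro sym2_pos_semidef) simp_all
  from operator_monotone_2x2(2)[OF h _ _ rs 1 this] show ?thesis by simp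
qed

lemma operator_monotone_mono:
  assumes h: "operator_monotone h" and "0 < x" "x \<le> y"
  shows "h x \<le> h y"
  using operator_monotone_upper_diag[OF h, of 0 x 1 y] assms by (cases "x = y") auto

text \<open>The lemma \<open>operator_monotone_upper_diag\<close> gives the concavity inequality at points strictly to the
  right of the convex combination. Slightly smaller weights \<open>t \<sigma>\<close> on \<open>z\<close> put \<open>y\<close> there, and then \<open>t\<close>
  tends to \<open>1\<close>.\<close>

lemma operator_monotone_concave:
  assumes h: "operator_monotone h" and xyz: "0 < x" "x < y" "y < z"
  shows "(z - y) * h x + (y - x) * h z \<le> (z - x) * h y"
proof -
  define \<sigma> where "\<sigma> = (y - x) / (z - x)"
  have \<sigma>: "0 < \<sigma>" "\<sigma> < 1" using xyz by (simp_all add: \<sigma>_def)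
  have y: "y = x + \<sigma> * (z - x)" using xyz by (simp add: \<sigma>_def)
  have "\<sigma> * (h z - h x) \<le> h y - h x"
  proof (rule field_le_mult_one_interval)
    fix t :: real assume t: "0 < t" "t < 1"
    have "t * \<sigma> < \<sigma>" using t \<sigma> by simp
    then have "(t * \<sigma>) * (z - x) < \<sigma> * (z - x)" using xyz by (intro mult_strict_right_mono) auto
    then have "(1 - t * \<sigma>) * x + t * \<sigma> * z < y" by (subst y) (simp add: algebra_simps)
    moreover have "t * \<sigma> \<le> 1" using \<open>t * \<sigma> < \<sigma>\<close> \<sigma> by linarith
    ultimately have "(1 - t * \<sigma>) * h x + t * \<sigma> * h z \<le> h y"
      using xyz t \<sigma> by (intro operator_monotone_upper_diag[OF h]) auto
    then show "t * (\<sigma> * (h z - h x)) \<le> h y - h x" by (simp add: algebra_simps)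
  qed
  then have "(z - x) * (\<sigma> * (h z - h x)) \<le> (z - x) * (h y - h x)"
    using xyz by (intro mult_left_mono) auto
  moreover have "(z - x) * (\<sigma> * (h z - h x)) = (y - x) * (h z - h x)"
    using xyz by (simp add: \<sigma>_def)
  ultimately show ?thesis by (simp add: algebra_simps)
qed

text \<open>By concavity and monotonicity \<open>h\<close> has the constant value \<open>h x\<close> from \<open>x\<close> onwards. For \<open>w < x\<close> take a
  matrix with eigenvalues \<open>w\<close> and \<open>2 x\<close> whose eigenvectors are tilted slightly against the axes, so that it still dominates
  the diagonal matrix with entries \<open>w / 2\<close>, \<open>x\<close>. The second diagonal entries give
  \<open>h x \<le> \<sigma> h w + (1 - \<sigma>) h x\<close> with \<open>\<sigma> > 0\<close>, so \<open>h w\<close> cannot be smaller than \<open>h x\<close>.\<close>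

lemma operator_monotone_const:
  assumes h: "operator_monotone h" and xy: "0 < x" "x < y" "h x = h y" and "0 < w"
  shows "h w = h x"
proof -
  have above: "h z = h x" if "x \<le> z" for z
  proof (rule antisym)
    show "h x \<le> h z" using operator_monotone_mono[OF h xy(1) that] .
    show "h z \<le> h x"
    proof (cases "z \<le> y")
      case True
      then show ?thesis using operator_monotone_mono[OF h, of z y] xy that by simp
    next
      case False
      then have "(y - x) * h z \<le> (y - x) * h x"
        using operator_monotone_concave[OF h xy(1,2), of z] xy(3) by (simp add: algebra_simps)
      then show ?thesis using xy(2) by simp
    qed
  qed
  show ?thesis
  proof (cases "x \<le> w")
    case False
    \<comment> \<open>As \<open>\<sigma>\<close> tends to \<open>0\<close> the difference of the two matrices tends to a positive diagonal matrix; with this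
      value its diagonal entries are still at least \<open>w / 2\<close> and \<open>x / 2\<close>, and the off-diagonal
      entry squared is at most \<open>4 \<sigma> x\<^sup>2 = (w / 2) (x / 2)\<close>.\<close>
    define \<sigma> where "\<sigma> = w / (16 * x)"
    have \<sigma>: "0 < \<sigma>" "\<sigma> \<le> 1/16" "16 * \<sigma> * x = w"
      using False \<open>0 < w\<close> xy(1) by (simp_all add: \<sigma>_def)
    have first: "w / 2 \<le> (1 - \<sigma>) * w + \<sigma> * (2 * x) - w / 2"
      using mult_left_mono[of w "2 * x" \<sigma>] False \<sigma>(1) xy(1) by (simp add: algebra_simps)
    have "\<sigma> * x \<le> x / 16" using \<sigma>(2) xy(1) by (simp add: mult.commute)
    moreover have "\<sigma> * w + (1 - \<sigma>) * (2 * x) - x = \<sigma> * w + x - 2 * (\<sigma> * x)"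
      by (simp add: algebra_simps)
    moreover have "0 \<le> \<sigma> * w" using \<sigma>(1) \<open>0 < w\<close> by simp
    ultimately have second: "x / 2 \<le> \<sigma> * w + (1 - \<sigma>) * (2 * x) - x"
      using xy(1) by linarith
    have "(w - 2 * x)\<^sup>2 \<le> (2 * x)\<^sup>2"
      unfolding abs_le_square_iff[symmetric] using False \<open>0 < w\<close> by linarith
    have "\<sigma> * (1 - \<sigma>) * (w - 2 * x)\<^sup>2 \<le> \<sigma> * 1 * (2 * x)\<^sup>2"
      using \<sigma> \<open>(w - 2 * x)\<^sup>2 \<le> (2 * x)\<^sup>2\<close> by (intro mult_mono) auto
    also have "\<dots> = (w / 2) * (x / 2)"
      unfolding \<sigma>(3)[symmetric] by (simp add: power2_eq_square)
    also have "\<dots> \<le> ((1 - \<sigma>) * w + \<sigma> * (2 * x) - w / 2) * (\<sigma> * w + (1 - \<sigma>) * (2 * x) - x)"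
      using first second \<open>0 < w\<close> xy(1) by (intro mult_mono) auto
    finally have "h x \<le> \<sigma> * h w + (1 - \<sigma>) * h (2 * x)"
      using first \<sigma> \<open>0 < w\<close> xy(1) by (intro operator_monotone_lower_diag[OF h, of \<sigma> w "2 * x" "w / 2" x]) auto
    also have "h (2 * x) = h x" using above[of "2 * x"] xy(1) by simp
    finally have "\<sigma> * h x \<le> \<sigma> * h w" by (simp add: algebra_simps)
    then have "h x \<le> h w" using \<sigma>(1) by simp
    moreover have "h w \<le> h x" using operator_monotone_mono[OF h \<open>0 < w\<close>, of x] False by simp
    ultimately show ?thesis by simp
  qed (rule above)
qed

lemma operator_monotone_strict_mono:
  assumes h: "operator_monotone h" and "\<not> affine_on_pos h" and xy: "0 < x" "x < y"
  shows "h x < h y"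
proof -
  have "h x \<noteq> h y"
  proof
    assume "h x = h y"
    then have "h w = h x + 0 * w" if "w > 0" for w
      unfolding mult_zero_left add_0_right by (rule operator_monotone_const[OF h xy _ that])
    then show False using \<open>\<not> affine_on_pos h\<close> unfolding affine_on_pos_def by blast
  qed
  then show ?thesis using operator_monotone_mono[OF h xy(1), of y] xy(2) by simp
qed

section \<open>Linearizable means\<close>

text \<open>If \<open>a = 0\<close>, the chord of \<open>b t\<^sup>2\<close> through its points at \<open>x\<close> and \<open>y\<close> meets the axis at a point \<open>w\<close>
  between \<open>0\<close> and \<open>x\<close>. A concave \<open>h\<close> lies below the extended chord there, contrary to \<open>h w > 0\<close>.\<close>

lemma two_parabola_points:
  assumes pos: "\<And>x. x > 0 \<Longrightarrow> h x > (0::real)"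
    and mono: "\<And>x y. 0 < x \<Longrightarrow> x < y \<Longrightarrow> h x < h y"
    and concave: "\<And>x y z. 0 < x \<Longrightarrow> x < y \<Longrightarrow> y < z \<Longrightarrow> (z - y) * h x + (y - x) * h z \<le> (z - x) * h y"
    and xy: "0 < x" "x < y" and hx: "h x = a + b * x\<^sup>2" and hy: "h y = a + b * y\<^sup>2"
  shows "b > 0" "a \<noteq> 0"
proof -
  have "x\<^sup>2 < y\<^sup>2" using xy by (simp add: power_strict_mono)
  moreover have "b * x\<^sup>2 < b * y\<^sup>2" using mono[OF xy] by (simp add: hx hy)
  ultimately show "b > 0" by (simp add: mult_less_cancel_left)
  show "a \<noteq> 0"
  proof
    assume "a = 0"
    \<comment> \<open>The chord is \<open>b ((x + y) t - x y)\<close> as a function of \<open>t\<close>.\<close>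
    define w where "w = x * y / (x + y)"
    have w: "0 < w" "w < x" "w * (x + y) = x * y"
      using xy by (simp_all add: w_def field_simps)
    have "(x - w) * y\<^sup>2 - (y - w) * x\<^sup>2 = (y - x) * (x * y - w * (x + y))"
      by (simp add: power2_eq_square algebra_simps)
    then have "(x - w) * y\<^sup>2 = (y - w) * x\<^sup>2" using w(3) by simp
    then have "(x - w) * h y = (y - w) * h x"
      by (simp add: hx hy \<open>a = 0\<close>) 
    moreover have "(y - x) * h w + (x - w) * h y \<le> (y - w) * h x"
      using concave[OF w(1,2) xy(2)] .
    moreover have "(y - x) * h w > 0" using pos[OF w(1)] xy by simp
    ultimately show False by linarith
  qed
qed

lemma card_le_2_if_no_three:
  fixes T :: "'a::linorder set"
  assumes "finite T" and no3: "\<And>x y z. x \<in> T \<Longrightarrow> y \<in> T \<Longrightarrow> z \<in> T \<Longrightarrow> x < y \<Longrightarrow> y < z \<Longrightarrow> False"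
  shows "card T \<le> 2"
proof (rule ccontr)
  assume big: "\<not> card T \<le> 2"
  then have "T \<noteq> {}" by auto
  have "\<not> T \<subseteq> {Min T, Max T}"
  proof
    assume "T \<subseteq> {Min T, Max T}"
    then have "card T \<le> card {Min T, Max T}" by (intro card_mono) auto
    also have "\<dots> \<le> 2" by (simp add: card_insert_if)
    finally show False using big by simp
  qed
  then obtain y where y: "y \<in> T" "y \<noteq> Min T" "y \<noteq> Max T" by auto
  have "Min T \<in> T" "Max T \<in> T" using \<open>finite T\<close> \<open>T \<noteq> {}\<close> by auto
  moreover have "Min T < y" "y < Max T"
    using y \<open>finite T\<close> by (metis Min_le less_le, metis Max_ge less_le)
  ultimately show False using no3 y(1) by blast
qed

lemma pos_def_diagonal_entry:
  fixes A :: "'a::star_division mat"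
  assumes A: "A \<in> pos_def_mats n" and i: "i < n"
  shows "A $$ (i, i) \<noteq> 0"
proof
  assume "A $$ (i, i) = 0"
  moreover have "quad_form A (unit_vec n i) = A $$ (i, i)"
    using pos_defD(1)[OF A] i
    by (simp add: quad_form_inner inner_def mat_app_def unit_vec_def if_distrib if_distribR cong: if_cong)
  moreover have "unit_vec n i \<noteq> (0\<^sub>v n :: 'a vec)" using i by simp
  moreover have "real_part (quad_form A v) > 0" if "v \<in> carrier_vec n" "v \<noteq> 0\<^sub>v n" for v
    using A that by (simp add: pos_def_mats_iff)
  ultimately show False by (metis less_irrefl real_part_zero unit_vec_carrier)
qed

lemma of_real_smult_mult:
  fixes X Y :: "'a::star_division mat"
  assumes "X \<in> carrier_mat n n" "Y \<in> carrier_mat n n"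
  shows "X * (of_real r \<cdot>\<^sub>m Y) = of_real r \<cdot>\<^sub>m (X * Y)" "(of_real r \<cdot>\<^sub>m X) * Y = of_real r \<cdot>\<^sub>m (X * Y)"
proof -
  show "X * (of_real r \<cdot>\<^sub>m Y) = of_real r \<cdot>\<^sub>m (X * Y)"
  proof (rule eq_matI)
    fix i j assume "i < dim_row (of_real r \<cdot>\<^sub>m (X * Y))" "j < dim_col (of_real r \<cdot>\<^sub>m (X * Y))"
    then show "(X * (of_real r \<cdot>\<^sub>m Y)) $$ (i, j) = (of_real r \<cdot>\<^sub>m (X * Y)) $$ (i, j)"
      using assms
      by (simp add: scalar_prod_def of_real_def scaleR_sum_right)
  qed (use assms in auto)
  show "(of_real r \<cdot>\<^sub>m X) * Y = of_real r \<cdot>\<^sub>m (X * Y)"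
    using assms by (intro eq_matI) (auto simp: scalar_prod_def sum_distrib_left mult.assoc)
qed

text \<open>Conjugating by \<open>U\<close> turns \<open>f(C)\<close> and \<open>C\<close> into diagonal matrices and \<open>B = C A C\<close> into \<open>D M D\<close>, where
  \<open>M = U\<^sup>* A U\<close>; the claim is the \<open>(i, j)\<close> entry of the result.\<close>

lemma linearizable_eigenbasis:
  fixes A B :: "'a::star_division mat"
  assumes A: "A \<in> pos_def_mats n" and C: "C \<in> pos_def_mats n" and CAC: "C * A * C = B"
    and Ud: "diagonalizes U d C"
    and lin: "fun_calc f C * A * fun_calc f C = of_real a \<cdot>\<^sub>m A + of_real b \<cdot>\<^sub>m B"
    and i: "i < n" and j: "j < n"
  shows "(f (d i) * f (d j) - a - b * (d i * d j)) *\<^sub>R (conj_transpose U * A * U) $$ (i, j) = 0"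
proof -
  note Ac [simp] = pos_defD(1)[OF A] and Cc [simp] = pos_defD(1)[OF C]
  note U = diagonalizesD[OF Ud Cc]
  define V where "V = conj_transpose U"
  define M where "M = V * A * U"
  define D F where "D = mat_diag n (\<lambda>i. of_real (d i) :: 'a)"
    and "F = mat_diag n (\<lambda>i. of_real (f (d i)) :: 'a)"
  have c [simp]: "U \<in> carrier_mat n n" "V \<in> carrier_mat n n" "D \<in> carrier_mat n n" "F \<in> carrier_mat n n"
    "M \<in> carrier_mat n n"
    using U(1) by (simp_all add: V_def D_def F_def M_def)
  have UV: "U * V = 1\<^sub>m n" and VU: "V * U = 1\<^sub>m n" using U(2,3) by (simp_all add: V_def)
  have Ceq: "C = U * D * V" using U(5) by (simp add: D_def V_def)
  have fC: "fun_calc f C = U * F * V"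
    using fun_calc_diagonalizes[OF Cc Ud] by (simp add: F_def V_def)
  have Bc [simp]: "B \<in> carrier_mat n n" unfolding CAC[symmetric] by simp
  note assoc = square_mult_assoc[of _ n]
  have conj: "V * ((U * E * V) * A * (U * E * V)) * U = E * M * E" if "E \<in> carrier_mat n n" for E
    using that by (simp add: assoc square_mult_cancel[OF VU] VU M_def right_mult_one_mat[of _ n n])
  have "F * M * F = V * (of_real a \<cdot>\<^sub>m A + of_real b \<cdot>\<^sub>m B) * U"
    using conj[of F] lin by (simp add: fC)
  also have "\<dots> = of_real a \<cdot>\<^sub>m M + of_real b \<cdot>\<^sub>m (V * B * U)"
    by (simp add: mult_add_distrib_mat[of _ n n _ n] add_mult_distrib_mat[of _ n n _ _ n]
        of_real_smult_mult[of _ n] M_def)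
  also have "V * B * U = D * M * D"
    using conj[of D] by (simp add: CAC[symmetric] Ceq)
  finally have eq: "F * M * F = of_real a \<cdot>\<^sub>m M + of_real b \<cdot>\<^sub>m (D * M * D)" .
  have entry: "(mat_diag n (\<lambda>i. of_real (g i)) * M * mat_diag n (\<lambda>i. of_real (g i))) $$ (i, j)
      = (g i * g j) *\<^sub>R M $$ (i, j)" for g :: "nat \<Rightarrow> real"
    using i j by (simp add: mat_diag_mult_left[OF c(5)] mat_diag_mult_right[of _ n n] of_real_def mult.commute)
  have "(f (d i) * f (d j)) *\<^sub>R M $$ (i, j) = a *\<^sub>R M $$ (i, j) + b *\<^sub>R ((d i * d j) *\<^sub>R M $$ (i, j))"
  proof -
    have "(D * M * D) $$ (i, j) = (d i * d j) *\<^sub>R M $$ (i, j)" unfolding D_def by (rule entry)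
    moreover have "(F * M * F) $$ (i, j) = (f (d i) * f (d j)) *\<^sub>R M $$ (i, j)"
      unfolding F_def by (rule entry)
    moreover have "(of_real a \<cdot>\<^sub>m M + of_real b \<cdot>\<^sub>m (D * M * D)) $$ (i, j)
        = a *\<^sub>R M $$ (i, j) + b *\<^sub>R (D * M * D) $$ (i, j)"
      using i j carrier_matD[OF c(5)] carrier_matD[OF c(3)]
      by (simp add: of_real_def del: index_mult_mat(1))
    ultimately show ?thesis using eq by simp
  qed
  then show ?thesis by (simp add: algebra_simps M_def V_def)
qed

text \<open>The eigenvalues of \<open>C = A\<^sup>-\<^sup>1 \<sharp> B\<close> are abscissae of intersection points of \<open>h\<close> with a parabola, which bounds their number;
  and the matrix of \<open>A\<close> in an eigenbasis of \<open>C\<close> has no entries linking different eigenvalues, so that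
  \<open>A\<close> commutes with \<open>C\<close> and hence with \<open>B = C A C\<close>.\<close>

lemma linearizable_alt_mean:
  fixes A B :: "'a::star_division mat"
  assumes A: "A \<in> pos_def_mats n" and B: "B \<in> pos_def_mats n"
    and pos: "\<And>x. x > 0 \<Longrightarrow> h x > (0::real)"
    and mono: "\<And>x y. 0 < x \<Longrightarrow> x < y \<Longrightarrow> h x < h y"
    and concave: "\<And>x y z. 0 < x \<Longrightarrow> x < y \<Longrightarrow> y < z \<Longrightarrow> (z - y) * h x + (y - x) * h z \<le> (z - x) * h y"
    and f: "\<And>x. x > 0 \<Longrightarrow> f x = sqrt (h x)"
    and lin: "linearizable f A B"
  shows "finite (spec (geom_mean (mat_powr A (-1)) B)) \<and>
    card (spec (geom_mean (mat_powr A (-1)) B)) \<le> 2 \<and> A * B = B * A"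
proof -
  define C where "C = geom_mean (mat_powr A (-1)) B"
  have C: "C \<in> pos_def_mats n" and CAC: "C * A * C = B"
    unfolding C_def by (rule geom_mean_inverse_pos_def[OF A B])+
  obtain a b where ab: "fun_calc f C * A * fun_calc f C = of_real a \<cdot>\<^sub>m A + of_real b \<cdot>\<^sub>m B"
    using lin unfolding linearizable_def alt_mean_def C_def by blast
  obtain U d where Ud: "diagonalizes U d C" using spectral_theorem[OF C] by blast
  note Ac [simp] = pos_defD(1)[OF A] and Cc [simp] = pos_defD(1)[OF C]
  note U = diagonalizesD[OF Ud Cc]
  define V where "V = conj_transpose U"
  define M where "M = V * A * U"
  have c [simp]: "U \<in> carrier_mat n n" "V \<in> carrier_mat n n" "M \<in> carrier_mat n n"
    using U(1) by (simp_all add: V_def M_def)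
  have UV: "U * V = 1\<^sub>m n" and VU: "V * U = 1\<^sub>m n" using U(2,3) by (simp_all add: V_def)
  have M: "M \<in> pos_def_mats n"
    using pos_def_congruence[OF A c(1,2) VU] by (simp add: M_def V_def)
  have entry: "f (d i) * f (d j) = a + b * (d i * d j)" if "i < n" "j < n" "M $$ (i, j) \<noteq> 0" for i j
    using linearizable_eigenbasis[OF A C CAC Ud ab that(1,2)] that(3)
    by (simp add: M_def V_def)
  have parabola: "h (d i) = a + b * (d i)\<^sup>2" if "i < n" for i
    using entry[OF that that pos_def_diagonal_entry[OF M that]] U(4)[OF that] pos[of "d i"] f[of "d i"]
    by (simp add: power2_eq_square)
  have two: "b > 0 \<and> a \<noteq> 0" if "i < n" "j < n" "d i < d j" for i j
    using two_parabola_points[of h "d i" "d j" a b, OF pos mono concave U(4)[OF that(1)] that(3)]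
      parabola that by blast
  have "card (d ` {..<n}) \<le> 2"
  proof (rule card_le_2_if_no_three)
    fix x y z assume "x \<in> d ` {..<n}" "y \<in> d ` {..<n}" "z \<in> d ` {..<n}" and xyz: "x < y" "y < z"
    then have h: "h x = a + b * x\<^sup>2" "h y = a + b * y\<^sup>2" "h z = a + b * z\<^sup>2" and "x > 0" "b > 0"
      using parabola U(4) two by auto
    \<comment> \<open>The parabola lies strictly below its chords, whereas \<open>h\<close> lies above them.\<close>
    have "(z - y) * h x + (y - x) * h z - (z - x) * h y = b * ((z - x) * (z - y) * (y - x))"
      unfolding h by (simp add: power2_eq_square algebra_simps)
    also have "\<dots> > 0" using xyz \<open>b > 0\<close> by simp
    finally show False using concave[OF \<open>x > 0\<close> xyz] by simp
  qed simp
  moreover have sub: "spec C \<subseteq> of_real ` d ` {..<n}"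
    using spec_diagonalizes[OF Cc Ud] by (simp add: image_image)
  ultimately have card: "card (spec C) \<le> 2"
    using card_mono[OF _ sub] card_image_le[of "d ` {..<n}" "of_real :: real \<Rightarrow> 'a"] by simp
  have off: "M $$ (i, j) = 0" if ij: "i < n" "j < n" "d i \<noteq> d j" for i j
  proof (rule ccontr)
    assume "M $$ (i, j) \<noteq> 0"
    \<comment> \<open>Comparing the square of the off-diagonal relation with the product of the two diagonal ones.\<close>
    then have "(a + b * (d i * d j))\<^sup>2 = (f (d i))\<^sup>2 * (f (d j))\<^sup>2"
      using entry[OF ij(1,2)] by (simp flip: power_mult_distrib)
    also have "\<dots> = (a + b * (d i)\<^sup>2) * (a + b * (d j)\<^sup>2)"
      using U(4) ij pos f by (simp add: less_imp_le flip: parabola)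
    finally have "a * b * (d i - d j)\<^sup>2 = 0"
      by (simp add: power2_eq_square algebra_simps)
    moreover have "b > 0 \<and> a \<noteq> 0" using two ij by (metis linorder_neq_iff)
    ultimately show False using ij(3) by simp
  qed
  define D where "D = mat_diag n (\<lambda>i. of_real (d i) :: 'a)"
  have Dc [simp]: "D \<in> carrier_mat n n" by (simp add: D_def)
  have comm: "of_real (d i) * M $$ (i, j) = M $$ (i, j) * of_real (d j)" if "i < n" "j < n" for i j
    using off[OF that] by (cases "d i = d j") (simp_all add: real_scalar_commute)
  have DM: "D * M = M * D"
    unfolding D_def mat_diag_mult_left[OF c(3)] mat_diag_mult_right[OF c(3)]
    by (rule eq_matI) (simp_all add: comm)
  note assoc = square_mult_assoc[of _ n]
  have Ceq: "C = U * D * V" using U(5) by (simp add: D_def V_def)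
  have Aeq: "A = U * M * V"
    by (simp add: M_def assoc square_mult_cancel[OF UV] UV right_mult_one_mat[of _ n n])
  have "C * A = U * (D * M) * V"
    unfolding Ceq Aeq by (simp add: assoc square_mult_cancel[OF VU])
  also have "\<dots> = A * C"
    unfolding Ceq Aeq DM by (simp add: assoc square_mult_cancel[OF VU])
  finally have CA: "C * A = A * C" .
  have "A * B = (A * C) * (A * C)" by (simp add: assoc flip: CAC)
  also have "\<dots> = (C * A) * (C * A)" by (simp add: CA)
  also have "\<dots> = B * A" by (simp add: assoc flip: CAC)
  finally have "A * B = B * A" .
  then show ?thesis
    using card finite_subset[OF sub] by (simp add: C_def)
qed

theorem theorem4p2:
  fixes h f :: "real \<Rightarrow> real" and n :: nat
  assumes "n \<ge> 1"
    and "\<forall>x>0. h x > 0"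
    and "operator_monotone h"
    and "\<not> affine_on_pos h"
    and "h 1 = 1"
    and "\<forall>x>0. f x = sqrt (h x)"
  shows
    "(\<forall>A \<in> pos_def_mats n. \<forall>B \<in> pos_def_mats n.
        linearizable f A (B :: real mat) \<longrightarrow>
        finite (spec (geom_mean (mat_powr A (-1)) B)) \<and>
        card (spec (geom_mean (mat_powr A (-1)) B)) \<le> 2 \<and> A * B = B * A) \<and>
     (\<forall>A \<in> pos_def_mats n. \<forall>B \<in> pos_def_mats n.
        linearizable f A (B :: complex mat) \<longrightarrow>
        finite (spec (geom_mean (mat_powr A (-1)) B)) \<and>
        card (spec (geom_mean (mat_powr A (-1)) B)) \<le> 2 \<and> A * B = B * A) \<and>
     (\<forall>A \<in> pos_def_mats n. \<forall>B \<in> pos_def_mats n.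
        linearizable f A (B :: quat mat) \<longrightarrow>
        finite (spec (geom_mean (mat_powr A (-1)) B)) \<and>
        card (spec (geom_mean (mat_powr A (-1)) B)) \<le> 2 \<and> A * B = B * A)"
proof -
  have h: "h x > 0" "f x = sqrt (h x)" if "x > 0" for x
    using assms(2,6) that by auto
  note concave = operator_monotone_concave[OF assms(3)]
    and strict = operator_monotone_strict_mono[OF assms(3,4)]
  show ?thesis
    using linearizable_alt_mean[where 'a = real, OF _ _ h(1) strict concave h(2)]
      linearizable_alt_mean[where 'a = complex, OF _ _ h(1) strict concave h(2)]
      linearizable_alt_mean[where 'a = quat, OF _ _ h(1) strict concave h(2)]
    by (intro conjI[of "\<forall>A\<in>_. _ A"] ballI impI)
qed

end
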